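(* Let $n\ge 1$, let $P:\mathbb{R}^n\to\mathbb{R}$ be continuous, and let $p\ge 1$. Suppose there exist a real continuous function $Q$ on $\mathbb{R}^n$ and a real number $s_0>0$ such that $$|P(\xi)-Q(\xi)|\lesssim 1,\qquad |\xi|\to+\infty,$$ and such that for every $s>s_0$, $$\Big\|\sup_{0<t<1}|e^{itQ(D)}f|\Big\|_{L^p(B(0,1))}\lesssim \|f\|_{H^s(\mathbb{R}^n)}\qquad\text{for all } f\in H^s(\mathbb{R}^n).$$ Then for all $s>s_0$ and all $f\in H^s(\mathbb{R}^n)$, $$\Big\|\sup_{0<t<1}|e^{itP(D)}f|\Big\|_{L^p(B(0,1))}\lesssim \|f\|_{H^s(\mathbb{R}^n)}.$$
   Context: For a real continuous function $P$ on $\mathbb{R}^n$, the operator $e^{itP(D)}$ is given (formally) by $$e^{itP(D)}f(x)=\int_{\mathbb{R}^n}e^{ix\cdot\xi+itP(\xi)}\hat f(\xi)\,d\xi,$$ the solution of $\partial_t u-iP(D)u=0$, $u(x,0)=f(x)$, where $\hat f$ is the Fourier transform of $f$, normalised so that $f(x)=\int_{\mathbb{R}^n} e^{ix\cdot\xi}\hat f(\xi)\,d\xi$. The operator $e^{itQ(D)}$ is defined in the same way. $H^s(\mathbb{R}^n)$ is the usual $L^2$-based inhomogeneous Sobolev space, and $B(0,1)$ is the unit ball of $\mathbb{R}^n$ centred at $0$. "$|P(\xi)-Q(\xi)|\lesssim 1$, $|\xi|\to+\infty$" means there are constants $C,R_0>0$ with $|P(\xi)-Q(\xi)|\le C$ for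 all $|\xi|\ge R_0$. In the norm estimates, $A\lesssim B$ means $A\le CB$ with a constant $C$ independent of $f$ (it may depend on $s$, $p$, $n$, $P$, $Q$). *)

theory Defs
  imports "HOL-Analysis.Analysis"
begin

text \<open>
  For \<open>s > 0\<close> the space \<open>H\<^sup>s\<close> is contained in \<open>L\<^sup>2\<close>, but the Fourier transform of an element
  need not be integrable.  So the Fourier transform and the operators \<open>e\<^bsup>itP(D)\<^esup>\<close> are the
  \<open>L\<^sup>2\<close> (Plancherel) ones: limits in \<open>L\<^sup>2\<close>, as \<open>R \<rightarrow> \<infinity>\<close>, of the defining integrals truncated
  to the ball of radius \<open>R\<close>.
\<close>

definition L2 :: "(real ^ 'n \<Rightarrow> complex) set" where
  "L2 = {f \<in> borel_measurable lborel. integrable lborel (\<lambda>x. (cmod (f x))\<^sup>2)}"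

text \<open>The limit is determined up to null sets; \<open>SOME\<close> picks a Borel representative.\<close>

definition L2_lim :: "(real \<Rightarrow> real ^ 'n \<Rightarrow> complex) \<Rightarrow> real ^ 'n \<Rightarrow> complex" where
  "L2_lim F = (SOME u. u \<in> L2 \<and>
     ((\<lambda>R. \<integral>\<^sup>+x. ennreal ((cmod (F R x - u x))\<^sup>2) \<partial>lborel) \<longlongrightarrow> 0) at_top)"

text \<open>The factor \<open>(2\<pi>)\<^bsup>-n\<^esup>\<close> is the one for which the inversion formula reads
  \<open>f x = \<integral> e\<^bsup>ix\<cdot>\<xi>\<^esup> fourier f \<xi> d\<xi>\<close>.\<close>

definition fourier :: "(real ^ 'n \<Rightarrow> complex) \<Rightarrow> real ^ 'n \<Rightarrow> complex" where
  "fourier f = L2_lim (\<lambda>R \<xi>.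
     complex_of_real (1 / (2 * pi) ^ CARD('n)) *
       (LINT x : cball 0 R | lborel. cis (- (x \<bullet> \<xi>)) * f x))"

definition propagator ::
    "(real ^ 'n \<Rightarrow> real) \<Rightarrow> real \<Rightarrow> (real ^ 'n \<Rightarrow> complex) \<Rightarrow> real ^ 'n \<Rightarrow> complex" where
  "propagator P t f = L2_lim (\<lambda>R x.
     LINT \<xi> : cball 0 R | lborel. cis (x \<bullet> \<xi> + t * P \<xi>) * fourier f \<xi>)"

text \<open>Only used for \<open>s > 0\<close> (for \<open>s < 0\<close> one would have to start from tempered distributions).\<close>

definition sobolev :: "real \<Rightarrow> (real ^ 'n \<Rightarrow> complex) set" where
  "sobolev s = {f \<in> L2.
     integrable lborel (\<lambda>\<xi>. (1 + (norm \<xi>)\<^sup>2) powr s * (cmod (fourier f \<xi>))\<^sup>2)}"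

definition sobolev_norm :: "real \<Rightarrow> (real ^ 'n \<Rightarrow> complex) \<Rightarrow> real" where
  "sobolev_norm s f = sqrt (LINT \<xi> | lborel. (1 + (norm \<xi>)\<^sup>2) powr s * (cmod (fourier f \<xi>))\<^sup>2)"

text \<open>
  Each \<open>e\<^bsup>itP(D)\<^esup> f\<close> is only defined up to a null set depending on \<open>t\<close>, so the supremum over
  the uncountable set of times is the supremum of almost-everywhere classes, that is, the least
  measurable function (up to null sets) dominating every member almost everywhere.  It always
  exists over a sigma-finite measure and does not depend on the representatives.  If the classes
  have representatives continuous in \<open>t\<close> (for instance when \<open>fourier f\<close> is integrable), it is
  their pointwise supremum.
\<close>

definition is_ess_SUP ::
    "'a measure \<Rightarrow> 'i set \<Rightarrow> ('i \<Rightarrow> 'a \<Rightarrow> ennreal) \<Rightarrow> ('a \<Rightarrow> ennreal) \<Rightarrow> bool" where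
  "is_ess_SUP M T u G \<longleftrightarrow>
     G \<in> borel_measurable M \<and>
     (\<forall>t\<in>T. AE x in M. u t x \<le> G x) \<and>
     (\<forall>H \<in> borel_measurable M. (\<forall>t\<in>T. AE x in M. u t x \<le> H x) \<longrightarrow> (AE x in M. G x \<le> H x))"

definition ess_SUP :: "'a measure \<Rightarrow> 'i set \<Rightarrow> ('i \<Rightarrow> 'a \<Rightarrow> ennreal) \<Rightarrow> 'a \<Rightarrow> ennreal" where
  "ess_SUP M T u = (SOME G. is_ess_SUP M T u G)"

definition maximal_function ::
    "(real ^ 'n \<Rightarrow> real) \<Rightarrow> (real ^ 'n \<Rightarrow> complex) \<Rightarrow> real ^ 'n \<Rightarrow> ennreal" where
  "maximal_function P f =
     ess_SUP lborel {0<..<1} (\<lambda>t x. ennreal (cmod (propagator P t f x)))"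

definition ennreal_powr :: "ennreal \<Rightarrow> real \<Rightarrow> ennreal" where
  "ennreal_powr y r = (if y = \<infinity> then \<infinity> else ennreal (enn2real y powr r))"

definition Lp_norm :: "real \<Rightarrow> (real ^ 'n) set \<Rightarrow> (real ^ 'n \<Rightarrow> ennreal) \<Rightarrow> ennreal" where
  "Lp_norm p A G = ennreal_powr (\<integral>\<^sup>+x\<in>A. ennreal_powr (G x) p \<partial>lborel) (1 / p)"

end

theory Submission
  imports Defs "HOL-Probability.Characteristic_Functions"
begin

text \<open>
  By continuity on a ball and the hypothesis outside it, \<open>\<bar>P - Q\<bar> \<le> M\<close> everywhere.  Expanding
  \<open>e\<^bsup>it(P-Q)\<^esup>\<close> gives \<open>e\<^bsup>itP(D)\<^esup> f = \<Sum>\<^sub>k (it)\<^sup>k / k! e\<^bsup>itQ(D)\<^esup> f\<^sub>k\<close> in \<open>L\<^sup>2\<close>, where \<open>f\<^sub>k\<close> has Fourier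
  transform \<open>(P-Q)\<^sup>k\<close> times that of \<open>f\<close> and therefore \<open>H\<^sup>s\<close> norm at most \<open>M\<^sup>k\<close> times that of \<open>f\<close>.
  For \<open>0 < t < 1\<close> the maximal function for \<open>P\<close> is thus dominated almost everywhere by
  \<open>\<Sum>\<^sub>k (1/k!)\<close> times the maximal functions for \<open>Q\<close> of the \<open>f\<^sub>k\<close>, and the bounds for the latter sum
  up because of the factorials.

  The \<open>f\<^sub>k\<close> exist because the \<open>L\<^sup>2\<close> Fourier transform is onto.  Plancherel's identity is obtained by
  inserting a Gaussian factor and letting it tend to \<open>1\<close>, using continuity of translation in \<open>L\<^sup>2\<close>;
  surjectivity follows from it because the truncated forward and inverse transforms are adjoint.
\<close>

section \<open>Square-integrable functions and continuity of translation\<close>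

text \<open>\<open>e^(itP(D)) f\<close> is \<open>e^(itQ(D))\<close> applied to the function whose
  transform is \<open>e^(it(P-Q))\<close> times that of \<open>f\<close>. This function moves with
  \<open>t\<close>, so the bound for \<open>Q\<close> cannot be applied to it under a supremum over
  \<open>t\<close>. The power series separates the variables: each term is a number depending on
  \<open>t\<close> times \<open>e^(itQ(D))\<close> of a function that does not. For \<open>t\<close>
  below \<open>1\<close> the coefficients are at most \<open>1 / k!\<close> uniformly, and bounded
  multipliers leave the Sobolev exponent alone, so nothing is lost in \<open>s\<close>.

  For fixed \<open>t\<close> the series converges in \<open>L2\<close> only, so domination holds off
  a null set depending on \<open>t\<close>, and there are uncountably many \<open>t\<close>. This is
  harmless because the maximal function is the least almost-everywhere majorant: one measurable
  function that majorises each time separately is enough. That a least majorant exists has to be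
  shown; rational times and continuity in \<open>t\<close> in \<open>L2\<close> supply it. The final
  constant \<open>2 * exp (2 * M) * C\<close> comes from summing \<open>M^k / k!\<close> with
  weights \<open>2^(k+1)\<close>.\<close>

definition L2sq :: "('a::euclidean_space \<Rightarrow> complex) \<Rightarrow> ennreal" where
  "L2sq g = (\<integral>\<^sup>+x. ennreal ((cmod (g x))\<^sup>2) \<partial>lborel)"

lemma cmod_add_square_le: "(cmod (a + b))\<^sup>2 \<le> 2 * (cmod a)\<^sup>2 + 2 * (cmod b)\<^sup>2"
proof -
  have "(cmod (a + b))\<^sup>2 \<le> (cmod a + cmod b)\<^sup>2"
    by (intro power_mono norm_triangle_ineq) auto
  also have "\<dots> \<le> 2 * (cmod a)\<^sup>2 + 2 * (cmod b)\<^sup>2"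
    using sum_squares_bound[of "cmod a" "cmod b"] by (simp add: power2_sum)
  finally show ?thesis .
qed

lemma L2sq_mono_AE: "(AE x in lborel. cmod (f x) \<le> cmod (g x)) \<Longrightarrow> L2sq f \<le> L2sq g"
  unfolding L2sq_def
  by (intro nn_integral_mono_AE) (auto elim!: eventually_mono intro!: ennreal_leI power_mono)

lemma L2sq_mono: "(\<And>x. cmod (f x) \<le> cmod (g x)) \<Longrightarrow> L2sq f \<le> L2sq g"
  by (rule L2sq_mono_AE) auto

text \<open>Squared norms obey the triangle inequality only up to a factor 2. The limits below
  tolerate such constants; exact values come from Plancherel's identity and adjointness.\<close>

lemma L2sq_add_le:
  assumes [measurable]: "f \<in> borel_measurable borel" "g \<in> borel_measurable borel"
  shows "L2sq (\<lambda>x. f x + g x) \<le> 2 * L2sq f + 2 * L2sq g"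
proof -
  have "L2sq (\<lambda>x. f x + g x) \<le>
      (\<integral>\<^sup>+x. 2 * ennreal ((cmod (f x))\<^sup>2) + 2 * ennreal ((cmod (g x))\<^sup>2) \<partial>lborel)"
    unfolding L2sq_def
  proof (rule nn_integral_mono)
    fix x
    have "ennreal ((cmod (f x + g x))\<^sup>2) \<le> ennreal (2 * (cmod (f x))\<^sup>2 + 2 * (cmod (g x))\<^sup>2)"
      by (intro ennreal_leI cmod_add_square_le)
    then show "ennreal ((cmod (f x + g x))\<^sup>2) \<le>
        2 * ennreal ((cmod (f x))\<^sup>2) + 2 * ennreal ((cmod (g x))\<^sup>2)"
      by (simp add: ennreal_mult)
  qed
  also have "\<dots> = 2 * L2sq f + 2 * L2sq g"
    unfolding L2sq_def by (simp add: nn_integral_add nn_integral_cmult)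
  finally show ?thesis .
qed

lemma L2sq_cmult:
  assumes [measurable]: "f \<in> borel_measurable borel"
  shows "L2sq (\<lambda>x. c * f x) = ennreal ((cmod c)\<^sup>2) * L2sq f"
  unfolding L2sq_def
  by (subst nn_integral_cmult[symmetric]) (auto simp: norm_mult power_mult_distrib ennreal_mult)

lemma L2sq_uminus: "L2sq (\<lambda>x. - f x) = L2sq f"
  by (simp add: L2sq_def)

lemma L2sq_diff_le:
  assumes "f \<in> borel_measurable borel" "g \<in> borel_measurable borel"
  shows "L2sq (\<lambda>x. f x - g x) \<le> 2 * L2sq f + 2 * L2sq g"
  using L2sq_add_le[of f "\<lambda>x. - g x"] assms by (simp add: L2sq_uminus)

lemma L2sq_diff_commute: "L2sq (\<lambda>x. f x - g x) = L2sq (\<lambda>x. g x - f x)"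
  by (simp add: L2sq_def norm_minus_commute)

lemma L2sq_triangle:
  assumes [measurable]: "f \<in> borel_measurable borel" "g \<in> borel_measurable borel" "h \<in> borel_measurable borel"
  shows "L2sq (\<lambda>x. f x - h x) \<le> 2 * L2sq (\<lambda>x. f x - g x) + 2 * L2sq (\<lambda>x. g x - h x)"
  using L2sq_add_le[of "\<lambda>x. f x - g x" "\<lambda>x. g x - h x"] by simp

lemma L2sq_eq_0_iff:
  assumes [measurable]: "f \<in> borel_measurable borel"
  shows "L2sq f = 0 \<longleftrightarrow> (AE x in lborel. f x = 0)"
  unfolding L2sq_def by (subst nn_integral_0_iff_AE) auto

lemma L2sq_finite_diff:
  assumes "f \<in> borel_measurable borel" "g \<in> borel_measurable borel" "L2sq f < top" "L2sq g < top"
  shows "L2sq (\<lambda>x. f x - g x) < top"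
  by (rule le_less_trans[OF L2sq_diff_le]) (use assms in \<open>auto simp: ennreal_mult_less_top\<close>)

lemma L2sq_finite_add:
  assumes "f \<in> borel_measurable borel" "g \<in> borel_measurable borel" "L2sq f < top" "L2sq g < top"
  shows "L2sq (\<lambda>x. f x + g x) < top"
  by (rule le_less_trans[OF L2sq_add_le]) (use assms in \<open>auto simp: ennreal_mult_less_top\<close>)

lemma L2sq_translate:
  assumes [measurable]: "f \<in> borel_measurable borel"
  shows "L2sq (\<lambda>x. f (x + a)) = L2sq f"
proof -
  have "L2sq f = (\<integral>\<^sup>+x. ennreal ((cmod (f x))\<^sup>2) \<partial>distr lborel borel ((+) a))"
    unfolding L2sq_def lborel_distr_plus ..
  also have "\<dots> = L2sq (\<lambda>x. f (x + a))"
    unfolding L2sq_def by (subst nn_integral_distr) (auto simp: add.commute)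
  finally show ?thesis ..
qed

lemma integrable_square_iff_L2sq:
  assumes [measurable]: "f \<in> borel_measurable borel"
  shows "integrable lborel (\<lambda>x. (cmod (f x))\<^sup>2) \<longleftrightarrow> L2sq f < top"
  unfolding L2sq_def by (subst integrable_iff_bounded) auto

lemma L2sq_eq_integral:
  assumes "integrable lborel (\<lambda>x. (cmod (f x))\<^sup>2)"
  shows "L2sq f = ennreal (LINT x|lborel. (cmod (f x))\<^sup>2)"
  unfolding L2sq_def using assms by (intro nn_integral_eq_integral) auto

lemma L2sq_tendsto_0_dominated:
  assumes [measurable]: "\<And>n. f n \<in> borel_measurable borel" "w \<in> borel_measurable borel"
    and "L2sq w < top" "\<And>n. AE x in lborel. cmod (f n x) \<le> cmod (w x)"
    and lim: "AE x in lborel. (\<lambda>n. f n x) \<longlonglongrightarrow> 0"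
  shows "(\<lambda>n. L2sq (f n)) \<longlonglongrightarrow> 0"
proof -
  have "(\<lambda>n. \<integral>\<^sup>+x. ennreal ((cmod (f n x))\<^sup>2) \<partial>lborel) \<longlonglongrightarrow> (\<integral>\<^sup>+x. 0 \<partial>(lborel::'a measure))"
  proof (rule nn_integral_dominated_convergence[where w="\<lambda>x. ennreal ((cmod (w x))\<^sup>2)"])
    show "AE x in lborel. ennreal ((cmod (f n x))\<^sup>2) \<le> ennreal ((cmod (w x))\<^sup>2)" for n
      using assms(4)[of n] by eventually_elim (auto intro!: ennreal_leI power_mono)
    show "AE x in lborel. (\<lambda>n. ennreal ((cmod (f n x))\<^sup>2)) \<longlonglongrightarrow> 0"
      using lim
    proof eventually_elim
      case (elim x)
      have "(\<lambda>n. ennreal ((cmod (f n x))\<^sup>2)) \<longlonglongrightarrow> ennreal ((cmod 0)\<^sup>2)"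
        by (intro tendsto_intros elim)
      then show ?case by simp
    qed
  qed (use assms(3) in \<open>auto simp: L2sq_def\<close>)
  then show ?thesis by (simp add: L2sq_def)
qed

text \<open>The squares tend to 0 in \<open>L1\<close>, where almost everywhere convergent
  subsequences are available.\<close>

lemma L2sq_tendsto_0_AE_subseq:
  assumes [measurable]: "\<And>n. f n \<in> borel_measurable borel"
    and fin: "\<And>n. L2sq (f n) < top" and lim: "(\<lambda>n. L2sq (f n)) \<longlonglongrightarrow> 0"
  shows "\<exists>r::nat \<Rightarrow> nat. strict_mono r \<and> (AE x in lborel. (\<lambda>n. f (r n) x) \<longlonglongrightarrow> 0)"
proof -
  have int: "integrable lborel (\<lambda>x. (cmod (f n x))\<^sup>2)" for n
    using fin by (simp add: integrable_square_iff_L2sq)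
  have "(\<lambda>n. enn2real (L2sq (f n))) \<longlonglongrightarrow> 0"
    using tendsto_enn2real[of _ 0] lim by simp
  then have "(\<lambda>n. LINT x|lborel. norm ((cmod (f n x))\<^sup>2)) \<longlonglongrightarrow> 0"
    by (simp add: L2sq_eq_integral[OF int])
  from tendsto_L1_AE_subseq[OF int this] obtain r :: "nat \<Rightarrow> nat" where
    r: "strict_mono r" "AE x in lborel. (\<lambda>n. (cmod (f (r n) x))\<^sup>2) \<longlonglongrightarrow> 0" by blast
  from r(2) have "AE x in lborel. (\<lambda>n. f (r n) x) \<longlonglongrightarrow> 0"
  proof eventually_elim
    case (elim x)
    from tendsto_real_sqrt[OF elim] show ?case by (simp add: tendsto_norm_zero_iff)
  qed
  with r(1) show ?thesis by blast
qed

section \<open>Continuity of translation in L2\<close>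

definition L2_translation_continuous :: "('a::euclidean_space \<Rightarrow> complex) \<Rightarrow> bool" where
  "L2_translation_continuous g \<longleftrightarrow>
     (\<forall>z::nat \<Rightarrow> 'a. z \<longlonglongrightarrow> 0 \<longrightarrow> (\<lambda>n. L2sq (\<lambda>x. g (x + z n) - g x)) \<longlonglongrightarrow> 0)"

lemma ennreal_tendsto_0_le:
  fixes X Y :: "'b \<Rightarrow> ennreal"
  assumes "(Y \<longlongrightarrow> 0) F" "\<And>n. X n \<le> Y n"
  shows "(X \<longlongrightarrow> 0) F"
  by (rule tendsto_sandwich[OF _ _ tendsto_const assms(1)]) (use assms(2) in auto)

lemma ennreal_tendsto_cmult_0:
  fixes X :: "'b \<Rightarrow> ennreal"
  assumes "(X \<longlongrightarrow> 0) F" "c < top"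
  shows "((\<lambda>n. c * X n) \<longlongrightarrow> 0) F"
  using ennreal_tendsto_cmult[of c X 0 F] assms by simp

lemma L2_translation_continuous_add:
  assumes "L2_translation_continuous f" "L2_translation_continuous g"
    and [measurable]: "f \<in> borel_measurable borel" "g \<in> borel_measurable borel"
  shows "L2_translation_continuous (\<lambda>x. f x + g x)"
  unfolding L2_translation_continuous_def
proof (intro allI impI)
  fix z :: "nat \<Rightarrow> 'a" assume z: "z \<longlonglongrightarrow> 0"
  have "(\<lambda>n. 2 * L2sq (\<lambda>x. f (x + z n) - f x) + 2 * L2sq (\<lambda>x. g (x + z n) - g x)) \<longlonglongrightarrow> 0 + 0"
    using assms(1,2) z unfolding L2_translation_continuous_def
    by (intro tendsto_add ennreal_tendsto_cmult_0) auto
  then have lim: "(\<lambda>n. 2 * L2sq (\<lambda>x. f (x + z n) - f x) + 2 * L2sq (\<lambda>x. g (x + z n) - g x)) \<longlonglongrightarrow> 0"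
    by simp
  show "(\<lambda>n. L2sq (\<lambda>x. f (x + z n) + g (x + z n) - (f x + g x))) \<longlonglongrightarrow> 0"
  proof (rule ennreal_tendsto_0_le[OF lim])
    fix n
    show "L2sq (\<lambda>x. f (x + z n) + g (x + z n) - (f x + g x)) \<le>
        2 * L2sq (\<lambda>x. f (x + z n) - f x) + 2 * L2sq (\<lambda>x. g (x + z n) - g x)"
      using L2sq_add_le[of "\<lambda>x. f (x + z n) - f x" "\<lambda>x. g (x + z n) - g x"]
      by (simp add: algebra_simps)
  qed
qed

lemma L2_translation_continuous_cmult:
  assumes "L2_translation_continuous f" and [measurable]: "f \<in> borel_measurable borel"
  shows "L2_translation_continuous (\<lambda>x. c * f x)"
  unfolding L2_translation_continuous_def
proof (intro allI impI)
  fix z :: "nat \<Rightarrow> 'a" assume z: "z \<longlonglongrightarrow> 0"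
  have "L2sq (\<lambda>x. c * f (x + z n) - c * f x) =
      ennreal ((cmod c)\<^sup>2) * L2sq (\<lambda>x. f (x + z n) - f x)" for n
    using L2sq_cmult[of "\<lambda>x. f (x + z n) - f x" c] by (simp add: algebra_simps)
  then show "(\<lambda>n. L2sq (\<lambda>x. c * f (x + z n) - c * f x)) \<longlonglongrightarrow> 0"
    using assms(1) z
    by (auto simp: L2_translation_continuous_def simp del: ennreal_power intro!: ennreal_tendsto_cmult_0)
qed

text \<open>Translation does not change the norm, so replacing \<open>g\<close> by
  \<open>f i\<close> costs the same at every shift \<open>z n\<close>: one fixes \<open>i\<close>
  and only then lets the shift tend to 0. The coefficients 6 and 4 come from using the triangle
  inequality with factor 2 twice.\<close>

lemma L2_translation_continuous_limit:
  fixes f :: "nat \<Rightarrow> 'a::euclidean_space \<Rightarrow> complex"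
  assumes [measurable]: "\<And>i. f i \<in> borel_measurable borel" "g \<in> borel_measurable borel"
    and TC: "\<And>i. L2_translation_continuous (f i)"
    and lim: "(\<lambda>i. L2sq (\<lambda>x. f i x - g x)) \<longlonglongrightarrow> 0"
  shows "L2_translation_continuous g"
  unfolding L2_translation_continuous_def
proof (intro allI impI)
  fix z :: "nat \<Rightarrow> 'a" assume z: "z \<longlonglongrightarrow> 0"
  have le: "L2sq (\<lambda>x. g (x + z n) - g x) \<le>
      6 * L2sq (\<lambda>x. f i x - g x) + 4 * L2sq (\<lambda>x. f i (x + z n) - f i x)" for i n
  proof -
    have "L2sq (\<lambda>x. g (x + z n) - g x) \<le>
        2 * L2sq (\<lambda>x. g (x + z n) - f i (x + z n)) + 2 * L2sq (\<lambda>x. f i (x + z n) - g x)"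
      by (rule L2sq_triangle) measurable
    also have "L2sq (\<lambda>x. g (x + z n) - f i (x + z n)) = L2sq (\<lambda>x. f i x - g x)"
      using L2sq_translate[of "\<lambda>x. g x - f i x" "z n"] by (simp add: L2sq_diff_commute)
    also have "L2sq (\<lambda>x. f i (x + z n) - g x) \<le>
        2 * L2sq (\<lambda>x. f i (x + z n) - f i x) + 2 * L2sq (\<lambda>x. f i x - g x)"
      by (rule L2sq_triangle) measurable
    finally have "L2sq (\<lambda>x. g (x + z n) - g x) \<le> 2 * L2sq (\<lambda>x. f i x - g x) +
        2 * (2 * L2sq (\<lambda>x. f i (x + z n) - f i x) + 2 * L2sq (\<lambda>x. f i x - g x))"
      by (simp add: add_left_mono mult_left_mono)
    also have "\<dots> = (2 + 4) * L2sq (\<lambda>x. f i x - g x) + 4 * L2sq (\<lambda>x. f i (x + z n) - f i x)"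
      unfolding distrib_right distrib_left by (simp add: ac_simps)
    finally show ?thesis by simp
  qed
  show "(\<lambda>n. L2sq (\<lambda>x. g (x + z n) - g x)) \<longlonglongrightarrow> 0"
  proof (rule tendsto_zero_ennreal)
    fix r :: real assume r: "0 < r"
    have "\<forall>\<^sub>F i in sequentially. 6 * L2sq (\<lambda>x. f i x - g x) < ennreal (r / 2)"
      using order_tendstoD(2)[OF ennreal_tendsto_cmult_0[OF lim, of 6], of "ennreal (r / 2)"] r
      by simp
    then obtain i where i: "6 * L2sq (\<lambda>x. f i x - g x) < ennreal (r / 2)"
      by (auto simp: eventually_sequentially)
    have "(\<lambda>n. L2sq (\<lambda>x. f i (x + z n) - f i x)) \<longlonglongrightarrow> 0"
      using TC[of i] z by (auto simp: L2_translation_continuous_def)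
    from order_tendstoD(2)[OF ennreal_tendsto_cmult_0[OF this, of 4], of "ennreal (r / 2)"] r
    have "\<forall>\<^sub>F n in sequentially. 4 * L2sq (\<lambda>x. f i (x + z n) - f i x) < ennreal (r / 2)"
      by simp
    then show "\<forall>\<^sub>F n in sequentially. L2sq (\<lambda>x. g (x + z n) - g x) < ennreal r"
    proof eventually_elim
      case (elim n)
      have "L2sq (\<lambda>x. g (x + z n) - g x) < ennreal (r / 2) + ennreal (r / 2)"
        using add_strict_mono[OF i elim] le[of n i] by (rule le_less_trans[rotated])
      then show ?case using r by (simp flip: ennreal_plus)
    qed
  qed
qed

text \<open>The squared distance is twice the measure of \<open>U\<close> minus twice the overlap of
  \<open>U\<close> with its translate. The overlap integrand lives on \<open>U\<close>, where
  openness gives pointwise convergence. Expanding the square avoids the boundary of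
  \<open>U\<close>, which may have positive measure and at which the translated indicators may fail
  to converge.\<close>

lemma L2_translation_continuous_indicator_open:
  fixes U :: "'a::euclidean_space set"
  assumes "open U" "emeasure lborel U < top"
  shows "L2_translation_continuous (indicator U)"
  unfolding L2_translation_continuous_def
proof (intro allI impI)
  fix z :: "nat \<Rightarrow> 'a" assume z: "z \<longlonglongrightarrow> 0"
  have [measurable]: "U \<in> sets borel" using assms by auto
  let ?I = "indicator U :: 'a \<Rightarrow> real"
  have intI: "integrable lborel ?I" using assms by auto
  have tr: "distr lborel borel (\<lambda>x. x + z n) = lborel" for n
  proof -
    have "(\<lambda>x. x + z n) = (+) (z n)" by (auto simp: fun_eq_iff)
    then show ?thesis by (simp add: lborel_distr_plus)
  qed
  have intT: "integrable lborel (\<lambda>x. ?I (x + z n))" for n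
    using integrable_distr[of "\<lambda>x. x + z n" lborel borel ?I] intI by (simp add: tr)
  have eqT: "(LINT x|lborel. ?I (x + z n)) = measure lborel U" for n
    using integral_distr[of "\<lambda>x. x + z n" lborel borel ?I] by (simp add: tr)
  have intP: "integrable lborel (\<lambda>x. ?I (x + z n) * ?I x)" for n
    by (rule Bochner_Integration.integrable_bound[OF intI]) (auto simp: indicator_def)
  have "(\<lambda>n. LINT x|lborel. ?I (x + z n) * ?I x) \<longlonglongrightarrow> (LINT x|lborel. ?I x)"
  proof (rule integral_dominated_convergence[where w="?I"])
    show "AE x in lborel. (\<lambda>n. ?I (x + z n) * ?I x) \<longlonglongrightarrow> ?I x"
    proof (rule AE_I2)
      fix x
      show "(\<lambda>n. ?I (x + z n) * ?I x) \<longlonglongrightarrow> ?I x"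
      proof (cases "x \<in> U")
        case True
        have "(\<lambda>n. x + z n) \<longlonglongrightarrow> x" using tendsto_add[OF tendsto_const z, of x] by simp
        then have "\<forall>\<^sub>F n in sequentially. x + z n \<in> U"
          using True assms(1) by (simp add: tendsto_def)
        then have "\<forall>\<^sub>F n in sequentially. ?I (x + z n) * ?I x = ?I x"
          by eventually_elim (auto simp: True)
        then show ?thesis by (rule tendsto_eventually)
      qed auto
    qed
  qed (auto simp: intI indicator_def)
  then have "(\<lambda>n. 2 * measure lborel U - 2 * (LINT x|lborel. ?I (x + z n) * ?I x)) \<longlonglongrightarrow>
      2 * measure lborel U - 2 * measure lborel U"
    by (intro tendsto_intros) simp
  moreover have "L2sq (\<lambda>x. indicator U (x + z n) - indicator U x) =
      ennreal (2 * measure lborel U - 2 * (LINT x|lborel. ?I (x + z n) * ?I x))" for n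
  proof -
    have sq: "(cmod (indicator U (x + z n) - indicator U x))\<^sup>2 =
        ?I (x + z n) + ?I x - 2 * (?I (x + z n) * ?I x)" for x
      by (auto simp: indicator_def)
    have "(LINT x|lborel. ?I (x + z n) + ?I x - 2 * (?I (x + z n) * ?I x)) =
        2 * measure lborel U - 2 * (LINT x|lborel. ?I (x + z n) * ?I x)"
      using intT intI intP by (simp add: eqT)
    then show ?thesis
      using intT intI intP by (subst L2sq_eq_integral) (simp_all add: sq del: indicator_simps)
  qed
  ultimately show "(\<lambda>n. L2sq (\<lambda>x. indicator U (x + z n) - indicator U x)) \<longlonglongrightarrow> 0"
    using tendsto_ennrealI by fastforce
qed

lemma L2sq_indicator:
  "A \<in> sets borel \<Longrightarrow> L2sq (indicator A) = emeasure lborel A"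
proof -
  assume A: "A \<in> sets borel"
  have "ennreal ((cmod (indicator A x))\<^sup>2) = indicator A x" for x
    by (auto simp: indicator_def)
  with A show ?thesis by (simp add: L2sq_def)
qed

text \<open>Outer regularity: open sets \<open>U n\<close> containing \<open>A\<close> with little
  excess measure approximate the indicator of \<open>A\<close>, since the squared distance of the
  indicators is the measure of \<open>U n - A\<close>.\<close>

lemma L2_translation_continuous_indicator:
  fixes A :: "'a::euclidean_space set"
  assumes [measurable]: "A \<in> sets borel" and fin: "emeasure lborel A < top"
  shows "L2_translation_continuous (indicator A)"
proof -
  have "\<exists>U. open U \<and> A \<subseteq> U \<and> emeasure lborel (U - A) < ennreal (1 / Suc n)" for n
  proof -
    obtain U where U: "open U" "A \<subseteq> U" "U - A \<in> lmeasurable"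
        "emeasure lebesgue (U - A) < ennreal (1 / Suc n)"
      using sets_lebesgue_outer_open[of A "1 / Suc n"] assms(1) by auto
    then have "U - A \<in> sets lborel" by auto
    with U show ?thesis by (auto simp: emeasure_completion)
  qed
  then obtain U where U: "\<And>n. open (U n)" "\<And>n. A \<subseteq> U n"
      "\<And>n. emeasure lborel (U n - A) < ennreal (1 / Suc n)" by metis
  have [measurable]: "U n \<in> sets borel" for n using U(1) by auto
  show ?thesis
  proof (rule L2_translation_continuous_limit[where f="\<lambda>n. indicator (U n)"])
    fix n
    have "emeasure lborel (U n) \<le> emeasure lborel A + emeasure lborel (U n - A)"
      using emeasure_subadditive[of A lborel "U n - A"] U(2)[of n] by (simp add: Un_absorb1)
    also have "\<dots> < top" using fin U(3)[of n] by (auto simp: less_top[symmetric])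
    finally show "L2_translation_continuous (indicator (U n))"
      using U(1) by (intro L2_translation_continuous_indicator_open)
  next
    have eq: "L2sq (\<lambda>x. indicator (U n) x - indicator A x) = emeasure lborel (U n - A)" for n
    proof -
      have "(\<lambda>x. indicator (U n) x - indicator A x :: complex) = indicator (U n - A)"
        using U(2)[of n] by (auto simp: indicator_def fun_eq_iff)
      then show ?thesis by (simp add: L2sq_indicator)
    qed
    have "(\<lambda>n. ennreal (1 / Suc n)) \<longlonglongrightarrow> ennreal 0"
      by (intro tendsto_ennrealI LIMSEQ_Suc[OF lim_1_over_n])
    then have "(\<lambda>n. ennreal (1 / Suc n)) \<longlonglongrightarrow> 0" by simp
    then show "(\<lambda>n. L2sq (\<lambda>x. indicator (U n) x - indicator A x)) \<longlonglongrightarrow> 0"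
      by (rule ennreal_tendsto_0_le) (use U(3) in \<open>auto simp: eq intro: less_imp_le\<close>)
  qed auto
qed

text \<open>Induction over the construction of nonnegative Borel functions. Finiteness of the norm
  is a premise of the induction, so it has to be passed down to the pieces; sums and increasing
  limits lie above their pieces.\<close>

lemma L2_translation_continuous_nonneg:
  fixes u :: "'a::euclidean_space \<Rightarrow> real"
  assumes "u \<in> borel_measurable borel" "\<And>x. 0 \<le> u x" "L2sq (\<lambda>x. of_real (u x)) < top"
  shows "L2_translation_continuous (\<lambda>x. of_real (u x))"
  using assms
proof (induction u rule: borel_measurable_induct_real)
  case (set A)
  have "(\<lambda>x. complex_of_real (indicator A x)) = indicator A" by (auto simp: indicator_def)
  with set show ?case
    using L2_translation_continuous_indicator[of A] by (simp add: L2sq_indicator)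
next
  case (mult u c)
  note [measurable] = mult(2)
  show ?case
  \<comment> \<open>For \<open>c = 0\<close> the finite norm of the product says nothing about
    \<open>u\<close>, so the induction hypothesis cannot be invoked.\<close>
  proof (cases "c = 0")
    case True
    then show ?thesis by (simp add: L2_translation_continuous_def L2sq_def)
  next
    case False
    have "L2sq (\<lambda>x. complex_of_real (u x)) \<noteq> top"
      using mult(5) False L2sq_cmult[of "\<lambda>x. complex_of_real (u x)" "of_real c"]
      by (auto simp: ennreal_mult_less_top)
    then have "L2_translation_continuous (\<lambda>x. complex_of_real (u x))" using mult by (simp add: less_top)
    from L2_translation_continuous_cmult[OF this, of "of_real c"] show ?thesis by simp
  qed
next
  case (add u v)
  note [measurable] = add(1,3)
  have abs: "\<bar>v x + u x\<bar> = v x + u x" "\<bar>u x\<bar> = u x" "\<bar>v x\<bar> = v x" for x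
    using add(2,4) by (simp_all add: add_nonneg_nonneg)
  have "L2sq (\<lambda>x. complex_of_real (u x)) < top"
    by (rule le_less_trans[OF L2sq_mono add.prems]) (use add(2,4) in \<open>simp add: abs del: of_real_add\<close>)
  moreover have "L2sq (\<lambda>x. complex_of_real (v x)) < top"
    by (rule le_less_trans[OF L2sq_mono add.prems]) (use add(2,4) in \<open>simp add: abs del: of_real_add\<close>)
  ultimately have "L2_translation_continuous (\<lambda>x. of_real (u x))" "L2_translation_continuous (\<lambda>x. of_real (v x))"
    using add by auto
  then show ?case using L2_translation_continuous_add[of "\<lambda>x. of_real (v x)" "\<lambda>x. of_real (u x)"] by simp
next
  case (seq U)
  note [measurable] = seq(1) assms(1)
  have le: "U i x \<le> u x" for i x
    using seq(3,4) by (intro incseq_le[of "\<lambda>i. U i x"]) (auto simp: incseq_def le_fun_def)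
  have "L2_translation_continuous (\<lambda>x. of_real (U i x))" for i
  proof (rule seq(5))
    show "L2sq (\<lambda>x. complex_of_real (U i x)) < top"
      by (rule le_less_trans[OF L2sq_mono seq(6)]) (use le seq(2) assms(2) in \<open>simp\<close>)
  qed
  then show ?case
  proof (rule L2_translation_continuous_limit[rotated 2])
    show "(\<lambda>i. L2sq (\<lambda>x. complex_of_real (U i x) - complex_of_real (u x))) \<longlonglongrightarrow> 0"
    proof (rule L2sq_tendsto_0_dominated[where w="\<lambda>x. of_real (u x)"])
      show "AE x in lborel. cmod (complex_of_real (U n x) - complex_of_real (u x)) \<le> cmod (complex_of_real (u x))" for n
        using le seq(2) assms(2) by (simp flip: of_real_diff)
      show "AE x in lborel. (\<lambda>n. complex_of_real (U n x) - complex_of_real (u x)) \<longlonglongrightarrow> 0"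
        using seq(4) by (auto intro!: AE_I2 LIM_zero tendsto_of_real)
    qed (use seq(6) in auto)
  qed auto
qed

text \<open>The positive and negative parts of \<open>Re (g x)\<close> and \<open>Im (g x)\<close>
  are bounded by \<open>cmod (g x)\<close>, so all four inherit the finite norm.\<close>

theorem L2_translation_continuous:
  fixes g :: "'a::euclidean_space \<Rightarrow> complex"
  assumes [measurable]: "g \<in> borel_measurable borel" and fin: "L2sq g < top"
  shows "L2_translation_continuous g"
proof -
  have part: "L2_translation_continuous (\<lambda>x. c * complex_of_real (h (g x)))"
    if [measurable]: "h \<in> borel_measurable borel" and h: "\<And>w. 0 \<le> h w" "\<And>w. h w \<le> cmod w" for h c
  proof (intro L2_translation_continuous_cmult L2_translation_continuous_nonneg)
    show "L2sq (\<lambda>x. complex_of_real (h (g x))) < top"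
      by (rule le_less_trans[OF L2sq_mono fin]) (use h in simp)
  qed (use h in auto)
  have "L2_translation_continuous (\<lambda>x. 1 * complex_of_real (max 0 (Re (g x))) + (-1) * complex_of_real (max 0 (- Re (g x)))
     + (\<i> * complex_of_real (max 0 (Im (g x))) + (-\<i>) * complex_of_real (max 0 (- Im (g x)))))"
    by (intro L2_translation_continuous_add part[of "\<lambda>w. max 0 (Re w)"] part[of "\<lambda>w. max 0 (- Re w)"]
        part[of "\<lambda>w. max 0 (Im w)"] part[of "\<lambda>w. max 0 (- Im w)"])
      (auto intro: abs_Re_le_cmod[THEN order_trans[rotated]] abs_Im_le_cmod[THEN order_trans[rotated]])
  also have "(\<lambda>x. 1 * complex_of_real (max 0 (Re (g x))) + (-1) * complex_of_real (max 0 (- Re (g x)))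
     + (\<i> * complex_of_real (max 0 (Im (g x))) + (-\<i>) * complex_of_real (max 0 (- Im (g x))))) = g"
    by (auto simp: fun_eq_iff complex_eq_iff max_def)
  finally show ?thesis .
qed

section \<open>Plancherel's identity\<close>

text \<open>The sign \<open>\<sigma>\<close> serves both directions: \<open>-1\<close> is the
  forward and \<open>1\<close> the inverse transform. No power of \<open>2 * pi\<close> is built in;
  the normalisation is added where it is wanted.\<close>

definition FT :: "real \<Rightarrow> ('a::euclidean_space \<Rightarrow> complex) \<Rightarrow> 'a \<Rightarrow> complex" where
  "FT \<sigma> g y = (LINT x|lborel. cis (\<sigma> * (y \<bullet> x)) * g x)"

lemma borel_measurable_cis [measurable (raw)]:
  "f \<in> borel_measurable M \<Longrightarrow> (\<lambda>x. cis (f x)) \<in> borel_measurable M"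
  by (rule borel_measurable_continuous_on) (auto intro!: continuous_intros)

lemma borel_measurable_cnj [measurable (raw)]:
  "f \<in> borel_measurable M \<Longrightarrow> (\<lambda>x. cnj (f x)) \<in> borel_measurable M"
  by (rule borel_measurable_continuous_on) (auto intro!: continuous_intros)

lemma integrable_cis_mult:
  assumes "integrable M g" and [measurable]: "h \<in> borel_measurable M"
  shows "integrable M (\<lambda>x. cis (h x) * g x)"
  by (rule Bochner_Integration.integrable_bound[OF assms(1)]) (use assms in \<open>auto simp: norm_mult\<close>)

lemma borel_measurable_FT [measurable]:
  assumes [measurable]: "g \<in> borel_measurable borel"
  shows "FT \<sigma> g \<in> borel_measurable borel"
  unfolding FT_def[abs_def] by measurable

lemma norm_FT_le: "cmod (FT \<sigma> g y) \<le> (LINT x|lborel. cmod (g x))"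
  unfolding FT_def by (rule order_trans[OF integral_norm_bound]) (simp add: norm_mult)

lemma FT_cmult: "FT \<sigma> (\<lambda>x. c * g x) y = c * FT \<sigma> g y"
proof -
  have "FT \<sigma> (\<lambda>x. c * g x) y = (LINT x|lborel. c * (cis (\<sigma> * (y \<bullet> x)) * g x))"
    unfolding FT_def by (simp add: ac_simps)
  then show ?thesis by (simp add: FT_def)
qed

lemma FT_add:
  assumes "integrable lborel f" "integrable lborel g"
  shows "FT \<sigma> (\<lambda>x. f x + g x) y = FT \<sigma> f y + FT \<sigma> g y"
  using integrable_cis_mult[OF assms(1), of "\<lambda>x. \<sigma> * (y \<bullet> x)"]
    integrable_cis_mult[OF assms(2), of "\<lambda>x. \<sigma> * (y \<bullet> x)"]
  unfolding FT_def distrib_left by (intro Bochner_Integration.integral_add) auto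

lemma FT_diff:
  assumes "integrable lborel f" "integrable lborel g"
  shows "FT \<sigma> (\<lambda>x. f x - g x) y = FT \<sigma> f y - FT \<sigma> g y"
  using integrable_cis_mult[OF assms(1), of "\<lambda>x. \<sigma> * (y \<bullet> x)"]
    integrable_cis_mult[OF assms(2), of "\<lambda>x. \<sigma> * (y \<bullet> x)"]
  unfolding FT_def right_diff_distrib by (intro Bochner_Integration.integral_diff) auto

lemma cnj_FT: "cnj (FT \<sigma> g y) = FT (-\<sigma>) (\<lambda>x. cnj (g x)) y"
proof -
  have "cnj (FT \<sigma> g y) = (LINT x|lborel. cnj (cis (\<sigma> * (y \<bullet> x)) * g x))"
    unfolding FT_def by (rule Bochner_Integration.integral_cnj[symmetric])
  also have "\<dots> = FT (-\<sigma>) (\<lambda>x. cnj (g x)) y"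
    unfolding FT_def by (intro Bochner_Integration.integral_cong refl) (simp add: cis_cnj)
  finally show ?thesis .
qed

text \<open>Fubini's theorem for a bounded kernel that is symmetric in \<open>x\<close> and
  \<open>y\<close>. Both the Gaussian computation and the adjointness of the two transforms rest on
  it.\<close>

lemma FT_multiplication_formula:
  assumes a: "integrable lborel a" and b: "integrable lborel b"
  shows "(LINT x|lborel. a x * FT \<sigma> b x) = (LINT x|lborel. FT \<sigma> a x * b x)"
proof -
  note [measurable] = borel_measurable_integrable[OF a, simplified] borel_measurable_integrable[OF b, simplified]
  let ?f = "\<lambda>x y. a x * (cis (\<sigma> * (x \<bullet> y)) * b y)"
  have "integrable (lborel \<Otimes>\<^sub>M lborel) (\<lambda>(x, y). ?f x y)"
  proof (rule lborel_pair.Fubini_integrable)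
    show "integrable lborel (\<lambda>x. LINT y|lborel. norm (case (x, y) of (x, y) \<Rightarrow> ?f x y))"
      using a by (simp add: norm_mult)
    show "AE x in lborel. integrable lborel (\<lambda>y. case (x, y) of (x, y) \<Rightarrow> ?f x y)"
      using b by (auto intro!: AE_I2 integrable_mult_right integrable_cis_mult)
  qed measurable
  from lborel_pair.Fubini_integral[OF this]
  have "(LINT x|lborel. LINT y|lborel. ?f x y) = (LINT y|lborel. LINT x|lborel. ?f x y)" ..
  also have "(LINT y|lborel. LINT x|lborel. ?f x y) =
      (LINT y|lborel. LINT x|lborel. (cis (\<sigma> * (y \<bullet> x)) * a x) * b y)"
    by (simp add: inner_commute ac_simps)
  finally show ?thesis by (simp add: FT_def)
qed

section \<open>Gaussian integrals in n dimensions\<close>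

lemma
  fixes f :: "'a::euclidean_space \<Rightarrow> real \<Rightarrow> complex"
  assumes f: "\<And>b. b \<in> Basis \<Longrightarrow> integrable lborel (f b)"
  shows integrable_lborel_prod: "integrable lborel (\<lambda>x::'a. \<Prod>b\<in>Basis. f b (x \<bullet> b))"
    and integral_lborel_prod:
      "(LINT x|lborel. (\<Prod>b\<in>Basis. f b (x \<bullet> b))) = (\<Prod>b\<in>Basis. (LINT x|lborel. f b x))"
proof -
  interpret product_sigma_finite "\<lambda>_::'a. lborel :: real measure" ..
  let ?P = "\<Pi>\<^sub>M b\<in>(Basis::'a set). (lborel :: real measure)"
  let ?T = "\<lambda>f::'a \<Rightarrow> real. \<Sum>b\<in>Basis. f b *\<^sub>R b"
  have [measurable]: "f b \<in> borel_measurable borel" if "b \<in> Basis" for b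
    using borel_measurable_integrable[OF f[OF that]] by simp
  have T: "?T \<in> measurable ?P borel" by measurable
  have m: "(\<lambda>x::'a. \<Prod>b\<in>Basis. f b (x \<bullet> b)) \<in> borel_measurable borel" by measurable
  have eq: "(\<Prod>b\<in>Basis. f b (?T x \<bullet> b)) = (\<Prod>b\<in>Basis. f b (x b))" for x
    by (intro prod.cong refl) simp
  show "integrable lborel (\<lambda>x::'a. \<Prod>b\<in>Basis. f b (x \<bullet> b))"
    unfolding lborel_eq[where 'a='a] integrable_distr_eq[OF T m] eq
    by (rule product_integrable_prod) (use f in auto)
  show "(LINT x|lborel. (\<Prod>b\<in>Basis. f b (x \<bullet> b))) = (\<Prod>b\<in>Basis. (LINT x|lborel. f b x))"
    unfolding lborel_eq[where 'a='a] integral_distr[OF T m] eq by (rule product_integral_prod) (use f in auto)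
qed

lemma integral_lborel_affine:
  fixes f :: "'a::euclidean_space \<Rightarrow> complex"
  assumes [measurable]: "f \<in> borel_measurable borel" and c: "c \<noteq> 0"
  shows "(LINT x|lborel. f x) = \<bar>c\<bar> ^ DIM('a) *\<^sub>R (LINT x|lborel. f (t + c *\<^sub>R x))"
proof -
  have "(LINT x|lborel. f x) =
      (LINT x|density (distr lborel borel (\<lambda>x. t + c *\<^sub>R x)) (\<lambda>_. \<bar>c\<bar> ^ DIM('a)). f x)"
    using lborel_affine[OF c, of t] by simp
  also have "\<dots> = (LINT x|distr lborel borel (\<lambda>x. t + c *\<^sub>R x). \<bar>c\<bar> ^ DIM('a) *\<^sub>R f x)"
    by (rule integral_density) auto
  also have "\<dots> = (LINT x|lborel. \<bar>c\<bar> ^ DIM('a) *\<^sub>R f (t + c *\<^sub>R x))"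
    by (rule integral_distr) auto
  finally show ?thesis by simp
qed

text \<open>Dilation by the standard deviation \<open>m\<close> reduces the integral to the
  characteristic function of the standard normal distribution.\<close>

lemma gaussian_cis_real:
  fixes t m :: real
  assumes m: "m > 0"
  shows "integrable lborel (\<lambda>x. cis (t * x) * of_real (exp (- x\<^sup>2 / (2 * m\<^sup>2))))"
    and "(LINT x|lborel. cis (t * x) * of_real (exp (- x\<^sup>2 / (2 * m\<^sup>2)))) =
      of_real (m * sqrt (2 * pi) * exp (- (m * t)\<^sup>2 / 2))"
proof -
  have eq: "exp (- x\<^sup>2 / (2 * m\<^sup>2)) = (m * sqrt (2 * pi)) * normal_density 0 m x" for x
    using m by (simp add: normal_density_def real_sqrt_mult)
  have "integrable lborel (\<lambda>x. complex_of_real (exp (- x\<^sup>2 / (2 * m\<^sup>2))))"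
    unfolding eq using m by (intro integrable_of_real integrable_mult_right integrable_normal_density)
  then show "integrable lborel (\<lambda>x. cis (t * x) * of_real (exp (- x\<^sup>2 / (2 * m\<^sup>2))))"
    by (rule integrable_cis_mult) auto
  have "complex_of_real (exp (- (m * t)\<^sup>2 / 2)) = char std_normal_distribution (m * t)"
    by (simp add: char_std_normal_distribution)
  also have "\<dots> = (LINT x|lborel. std_normal_density x *\<^sub>R cis ((m * t) * x))"
    unfolding char_def by (subst integral_density) (auto simp: cis_conv_exp)
  finally have std: "(LINT x|lborel. std_normal_density x *\<^sub>R cis ((m * t) * x)) =
      complex_of_real (exp (- (m * t)\<^sup>2 / 2))" ..
  have "(LINT x|lborel. cis (t * x) * of_real (exp (- x\<^sup>2 / (2 * m\<^sup>2)))) =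
      m *\<^sub>R (LINT x|lborel. cis (t * (m * x)) * of_real (exp (- (m * x)\<^sup>2 / (2 * m\<^sup>2))))"
    using lborel_integral_real_affine[of m "\<lambda>x. cis (t * x) * complex_of_real (exp (- x\<^sup>2 / (2 * m\<^sup>2)))" 0] m
    by simp
  also have "(\<lambda>x. cis (t * (m * x)) * complex_of_real (exp (- (m * x)\<^sup>2 / (2 * m\<^sup>2)))) =
      (\<lambda>x. sqrt (2 * pi) *\<^sub>R (std_normal_density x *\<^sub>R cis ((m * t) * x)))"
    using m by (auto simp: fun_eq_iff std_normal_density_def power_mult_distrib scaleR_conv_of_real ac_simps)
  finally show "(LINT x|lborel. cis (t * x) * of_real (exp (- x\<^sup>2 / (2 * m\<^sup>2)))) =
      of_real (m * sqrt (2 * pi) * exp (- (m * t)\<^sup>2 / 2))"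
    unfolding integral_scaleR_right std by (simp add: scaleR_conv_of_real)
qed

lemma
  fixes y :: "'a::euclidean_space"
  assumes m: "m > 0"
  shows integrable_gaussian_cis:
      "integrable lborel (\<lambda>x::'a. cis (y \<bullet> x) * of_real (exp (- (norm x)\<^sup>2 / (2 * m\<^sup>2))))"
    and integral_gaussian_cis:
      "(LINT x|lborel. cis (y \<bullet> x) * of_real (exp (- (norm x)\<^sup>2 / (2 * m\<^sup>2)))) =
        of_real ((m * sqrt (2 * pi)) ^ DIM('a) * exp (- (m * norm y)\<^sup>2 / 2))"
proof -
  have cis_sum: "cis (\<Sum>b\<in>A. h b) = (\<Prod>b\<in>A. cis (h b))" if "finite A" for h and A :: "'a set"
    using that by induction (auto simp: cis_mult[symmetric])
  have norm2: "(norm x)\<^sup>2 = (\<Sum>b\<in>Basis. (x \<bullet> b)\<^sup>2)" for x :: 'a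
    unfolding power2_norm_eq_inner by (subst euclidean_inner) (simp add: power2_eq_square)
  have eq: "cis (y \<bullet> x) * of_real (exp (- (norm x)\<^sup>2 / (2 * m\<^sup>2))) =
      (\<Prod>b\<in>Basis. cis ((y \<bullet> b) * (x \<bullet> b)) * of_real (exp (- (x \<bullet> b)\<^sup>2 / (2 * m\<^sup>2))))" for x :: 'a
    unfolding euclidean_inner[of y x] prod.distrib cis_sum[OF finite_Basis] norm2
    by (simp add: exp_sum[symmetric] sum_negf sum_divide_distrib flip: of_real_prod)
  show "integrable lborel (\<lambda>x::'a. cis (y \<bullet> x) * of_real (exp (- (norm x)\<^sup>2 / (2 * m\<^sup>2))))"
    unfolding eq by (intro integrable_lborel_prod gaussian_cis_real m)
  show "(LINT x|lborel. cis (y \<bullet> x) * of_real (exp (- (norm x)\<^sup>2 / (2 * m\<^sup>2)))) =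
        of_real ((m * sqrt (2 * pi)) ^ DIM('a) * exp (- (m * norm y)\<^sup>2 / 2))"
  proof -
    have "(LINT x|lborel. cis (y \<bullet> x) * of_real (exp (- (norm x)\<^sup>2 / (2 * m\<^sup>2)))) =
        (\<Prod>b\<in>Basis. (LINT x|lborel. cis ((y \<bullet> b) * x) * of_real (exp (- x\<^sup>2 / (2 * m\<^sup>2)))))"
      unfolding eq by (intro integral_lborel_prod gaussian_cis_real m)
    also have "\<dots> = of_real (\<Prod>b\<in>(Basis::'a set). m * sqrt (2 * pi) * exp (- (m * (y \<bullet> b))\<^sup>2 / 2))"
      by (simp only: gaussian_cis_real(2)[OF m] of_real_prod)
    also have "(\<Prod>b\<in>(Basis::'a set). m * sqrt (2 * pi) * exp (- (m * (y \<bullet> b))\<^sup>2 / 2)) =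
        (m * sqrt (2 * pi)) ^ DIM('a) * exp (- (m * norm y)\<^sup>2 / 2)"
      unfolding power_mult_distrib[of m "norm y"] norm2
      by (simp add: prod.distrib power_mult_distrib sum_distrib_left sum_negf sum_divide_distrib exp_sum[symmetric])
    finally show ?thesis .
  qed
qed

text \<open>The integral is the autocorrelation of \<open>g\<close> at the shift \<open>w\<close>.
  The polarisation identity for \<open>Re (a * cnj b)\<close> expresses its real part by the
  distance of \<open>g\<close> from its translate, which turns continuity of translation into
  continuity of this real part at \<open>0\<close>.\<close>

lemma real_integral_translation_product:
  fixes g :: "'a::euclidean_space \<Rightarrow> complex"
  assumes [measurable]: "g \<in> borel_measurable borel" and fin: "L2sq g < top"
  shows "integrable lborel (\<lambda>x. g x * cnj (g (x + w)))"
    and "Re (LINT x|lborel. g x * cnj (g (x + w))) =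
      enn2real (L2sq g) - enn2real (L2sq (\<lambda>x. g (x + w) - g x)) / 2"
    and "cmod (LINT x|lborel. g x * cnj (g (x + w))) \<le> 2 * enn2real (L2sq g)"
proof -
  let ?N = "\<lambda>f::'a \<Rightarrow> complex. LINT x|lborel. (cmod (f x))\<^sup>2"
  have i1: "integrable lborel (\<lambda>x. (cmod (g x))\<^sup>2)"
    using fin by (simp add: integrable_square_iff_L2sq)
  have i2: "integrable lborel (\<lambda>x. (cmod (g (x + w)))\<^sup>2)"
    using fin by (simp add: integrable_square_iff_L2sq L2sq_translate)
  have i3: "integrable lborel (\<lambda>x. (cmod (g (x + w) - g x))\<^sup>2)"
    using fin by (simp add: integrable_square_iff_L2sq L2sq_translate L2sq_finite_diff[of "\<lambda>x. g (x + w)" g, simplified])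
  have e: "enn2real (L2sq f) = ?N f" if "integrable lborel (\<lambda>x. (cmod (f x))\<^sup>2)" for f
    using that by (simp add: L2sq_eq_integral)
  have tr: "?N (\<lambda>x. g (x + w)) = ?N g"
    using e[OF i1] e[OF i2] by (simp add: L2sq_translate)
  have le: "norm (g x * cnj (g (x + w))) \<le> (cmod (g x))\<^sup>2 + (cmod (g (x + w)))\<^sup>2" for x
  proof -
    have "0 \<le> cmod (g x) * cmod (g (x + w))" by simp
    with sum_squares_bound[of "cmod (g x)" "cmod (g (x + w))"]
    show ?thesis unfolding norm_mult complex_mod_cnj by linarith
  qed
  show int: "integrable lborel (\<lambda>x. g x * cnj (g (x + w)))"
    by (rule Bochner_Integration.integrable_bound[OF Bochner_Integration.integrable_add[OF i1 i2]])
      (use le in \<open>auto intro!: AE_I2 order_trans[OF le]\<close>)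
  have "cmod (LINT x|lborel. g x * cnj (g (x + w))) \<le> (LINT x|lborel. norm (g x * cnj (g (x + w))))"
    by (rule integral_norm_bound)
  also have "\<dots> \<le> (LINT x|lborel. (cmod (g x))\<^sup>2 + (cmod (g (x + w)))\<^sup>2)"
    by (rule integral_mono) (use int i1 i2 le in auto)
  also have "\<dots> = 2 * enn2real (L2sq g)"
    using i1 i2 e[OF i1] tr by simp
  finally show "cmod (LINT x|lborel. g x * cnj (g (x + w))) \<le> 2 * enn2real (L2sq g)" .
  have key: "Re (a * cnj b) = ((cmod a)\<^sup>2 + (cmod b)\<^sup>2 - (cmod (b - a))\<^sup>2) / 2" for a b
    by (simp add: cmod_power2) (simp add: power2_eq_square algebra_simps)
  have "Re (LINT x|lborel. g x * cnj (g (x + w))) = (LINT x|lborel. Re (g x * cnj (g (x + w))))"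
    by (rule integral_Re[OF int, symmetric])
  also have "\<dots> =
      (LINT x|lborel. ((cmod (g x))\<^sup>2 + (cmod (g (x + w)))\<^sup>2 - (cmod (g (x + w) - g x))\<^sup>2) / 2)"
    unfolding key ..
  also have "\<dots> = ?N g - ?N (\<lambda>x. g (x + w) - g x) / 2"
    using i1 i2 i3 by (simp add: tr)
  finally show "Re (LINT x|lborel. g x * cnj (g (x + w))) =
      enn2real (L2sq g) - enn2real (L2sq (\<lambda>x. g (x + w) - g x)) / 2"
    using e[OF i1] e[OF i3] by simp
qed

text \<open>The multiplication formula is used twice. The Gaussian weight makes the bounded function
  \<open>cnj (FT \<sigma> g x)\<close> integrable, so one transform can be moved off
  \<open>g\<close>. Written out, that transform pairs a modulated Gaussian with the transform of
  \<open>cnj (g x)\<close>; moving this one too leaves the transform of the modulated Gaussian,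
  which is a Gaussian centred at \<open>x\<close>.\<close>

lemma gaussian_weighted_FT:
  fixes g :: "'a::euclidean_space \<Rightarrow> complex" and m :: real
  assumes g: "integrable lborel g" and \<sigma>: "\<bar>\<sigma>\<bar> = 1" and m: "m > 0"
  shows "(LINT x|lborel. of_real (exp (- (norm x)\<^sup>2 / (2 * m\<^sup>2))) * cnj (FT \<sigma> g x) * FT \<sigma> g x) =
    (LINT x|lborel. (LINT y|lborel. of_real ((m * sqrt (2 * pi)) ^ DIM('a) *
       exp (- (m * norm (x - y))\<^sup>2 / 2)) * cnj (g y)) * g x)"
proof -
  note [measurable] = borel_measurable_integrable[OF g, simplified]
  let ?\<gamma> = "\<lambda>x::'a. complex_of_real (exp (- (norm x)\<^sup>2 / (2 * m\<^sup>2)))"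
  have int\<gamma>: "integrable lborel ?\<gamma>" using integrable_gaussian_cis[OF m, of 0] by simp
  define B where "B = (LINT x|lborel. cmod (g x))"
  have B: "cmod (FT \<sigma> g x) \<le> B" for x unfolding B_def by (rule norm_FT_le)
  have inta: "integrable lborel (\<lambda>x. ?\<gamma> x * cnj (FT \<sigma> g x))"
  proof (rule Bochner_Integration.integrable_bound)
    show "integrable lborel (\<lambda>x. of_real B * ?\<gamma> x)" using int\<gamma> by simp
    show "AE x in lborel. norm (?\<gamma> x * cnj (FT \<sigma> g x)) \<le> norm (of_real B * ?\<gamma> x)"
      using order_trans[OF B abs_ge_self] by (auto simp: norm_mult mult.commute intro!: AE_I2 mult_right_mono)
  qed measurable
  have "(LINT x|lborel. ?\<gamma> x * cnj (FT \<sigma> g x) * FT \<sigma> g x) =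
      (LINT x|lborel. FT \<sigma> (\<lambda>x. ?\<gamma> x * cnj (FT \<sigma> g x)) x * g x)"
    by (rule FT_multiplication_formula[OF inta g])
  moreover have "FT \<sigma> (\<lambda>x. ?\<gamma> x * cnj (FT \<sigma> g x)) x =
      (LINT y|lborel. of_real ((m * sqrt (2 * pi)) ^ DIM('a) *
        exp (- (m * norm (x - y))\<^sup>2 / 2)) * cnj (g y))" for x
  proof -
    have "FT \<sigma> (\<lambda>x. ?\<gamma> x * cnj (FT \<sigma> g x)) x =
        (LINT y|lborel. (cis (\<sigma> * (x \<bullet> y)) * ?\<gamma> y) * FT (-\<sigma>) (\<lambda>x. cnj (g x)) y)"
      unfolding FT_def[of \<sigma> "\<lambda>x. ?\<gamma> x * cnj (FT \<sigma> g x)"] by (simp add: cnj_FT ac_simps)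
    also have "\<dots> = (LINT y|lborel. FT (-\<sigma>) (\<lambda>y. cis (\<sigma> * (x \<bullet> y)) * ?\<gamma> y) y * cnj (g y))"
      by (rule FT_multiplication_formula) (use g int\<gamma> in \<open>auto intro!: integrable_cis_mult\<close>)
    also have "\<dots> = (LINT y|lborel. of_real ((m * sqrt (2 * pi)) ^ DIM('a) *
        exp (- (m * norm (x - y))\<^sup>2 / 2)) * cnj (g y))"
    proof (intro Bochner_Integration.integral_cong refl arg_cong2[where f="(*)"])
      fix y
      show "FT (-\<sigma>) (\<lambda>y. cis (\<sigma> * (x \<bullet> y)) * ?\<gamma> y) y = of_real ((m * sqrt (2 * pi)) ^ DIM('a) * exp (- (m * norm (x - y))\<^sup>2 / 2))"
      proof -
      have "cis (- \<sigma> * (y \<bullet> z)) * (cis (\<sigma> * (x \<bullet> z)) * ?\<gamma> z) = cis ((\<sigma> *\<^sub>R (x - y)) \<bullet> z) * ?\<gamma> z" for z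
        unfolding mult.assoc[symmetric] cis_mult by (simp add: algebra_simps inner_diff_left)
      then have "FT (-\<sigma>) (\<lambda>y. cis (\<sigma> * (x \<bullet> y)) * ?\<gamma> y) y =
          (LINT z|lborel. cis ((\<sigma> *\<^sub>R (x - y)) \<bullet> z) * ?\<gamma> z)"
        unfolding FT_def by (simp only:)
      also have "\<dots> = of_real ((m * sqrt (2 * pi)) ^ DIM('a) * exp (- (m * norm (\<sigma> *\<^sub>R (x - y)))\<^sup>2 / 2))"
        by (rule integral_gaussian_cis[OF m])
      finally show ?thesis using \<sigma> by simp
      qed
    qed
    finally show ?thesis .
  qed
  ultimately show ?thesis by (simp only:)
qed

text \<open>Substituting \<open>y = x + z / m\<close> turns the concentrating kernel into a fixed
  Gaussian and cancels the power of \<open>m\<close>. After Fubini, \<open>m\<close> occurs only in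
  the shift of the autocorrelation of \<open>g\<close>, which is the form suited to letting
  \<open>m\<close> tend to infinity.\<close>

lemma gaussian_weighted_FT_rescaled:
  fixes g :: "'a::euclidean_space \<Rightarrow> complex" and m :: real
  assumes g: "integrable lborel g" and fin: "L2sq g < top" and \<sigma>: "\<bar>\<sigma>\<bar> = 1" and m: "m > 0"
  shows "(LINT x|lborel. of_real (exp (- (norm x)\<^sup>2 / (2 * m\<^sup>2))) * cnj (FT \<sigma> g x) * FT \<sigma> g x) =
    of_real (sqrt (2 * pi) ^ DIM('a)) * (LINT z|lborel. of_real (exp (- (norm z)\<^sup>2 / 2)) *
      (LINT x|lborel. g x * cnj (g (x + (1 / m) *\<^sub>R z))))"
proof -
  note [measurable] = borel_measurable_integrable[OF g, simplified]
  let ?e = "\<lambda>z::'a. exp (- (norm z)\<^sup>2 / 2)"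
  have inte: "integrable lborel (\<lambda>z. complex_of_real (?e z))" using integrable_gaussian_cis[of 1 0] by simp
  have inte': "integrable lborel ?e"
    using integrable_norm[OF inte] by simp
  let ?K = "sqrt (2 * pi) ^ DIM('a)"
  have inner: "(LINT y|lborel. of_real ((m * sqrt (2 * pi)) ^ DIM('a) *
       exp (- (m * norm (x - y))\<^sup>2 / 2)) * cnj (g y)) =
     of_real ?K * (LINT z|lborel. of_real (?e z) * cnj (g (x + (1 / m) *\<^sub>R z)))" for x
  proof -
    have "(LINT y|lborel. of_real ((m * sqrt (2 * pi)) ^ DIM('a) *
         exp (- (m * norm (x - y))\<^sup>2 / 2)) * cnj (g y)) =
      \<bar>1 / m\<bar> ^ DIM('a) *\<^sub>R (LINT z|lborel. of_real ((m * sqrt (2 * pi)) ^ DIM('a) *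
         exp (- (m * norm (x - (x + (1 / m) *\<^sub>R z)))\<^sup>2 / 2)) * cnj (g (x + (1 / m) *\<^sub>R z)))"
      by (rule integral_lborel_affine) (use m in auto)
    also have "\<dots> = \<bar>1 / m\<bar> ^ DIM('a) *\<^sub>R (LINT z|lborel. of_real ((m * sqrt (2 * pi)) ^ DIM('a)) *
         (of_real (?e z) * cnj (g (x + (1 / m) *\<^sub>R z))))"
      using m by (simp add: ac_simps)
    also have "\<dots> = of_real (\<bar>1 / m\<bar> ^ DIM('a) * (m * sqrt (2 * pi)) ^ DIM('a)) *
         (LINT z|lborel. of_real (?e z) * cnj (g (x + (1 / m) *\<^sub>R z)))"
      by (simp add: scaleR_conv_of_real)
    also have "\<bar>1 / m\<bar> ^ DIM('a) * (m * sqrt (2 * pi)) ^ DIM('a) = ?K"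
      using m by (simp flip: power_mult_distrib)
    finally show ?thesis .
  qed
  let ?f = "\<lambda>x z. of_real (?e z) * (g x * cnj (g (x + (1 / m) *\<^sub>R z)))"
  \<comment> \<open>Joint integrability for Fubini: a product is at most the sum of the squares, so
    for each \<open>z\<close> the inner integral is at most the Gaussian factor times
    \<open>2 * L2sq g\<close>.\<close>
  have int2: "integrable (lborel \<Otimes>\<^sub>M lborel) (\<lambda>(z, x). ?f x z)"
  proof (rule integrableI_bounded)
    have "(\<integral>\<^sup>+ p. ennreal (norm (case p of (z, x) \<Rightarrow> ?f x z)) \<partial>(lborel \<Otimes>\<^sub>M lborel)) =
        (\<integral>\<^sup>+z. \<integral>\<^sup>+x. ennreal (norm (?f x z)) \<partial>lborel \<partial>lborel)"
      by (subst lborel.nn_integral_fst[symmetric]) auto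
    also have "\<dots> \<le> (\<integral>\<^sup>+z. ennreal (?e z) * (2 * L2sq g) \<partial>lborel)"
    proof (rule nn_integral_mono)
      fix z
      have "(\<integral>\<^sup>+x. ennreal (norm (?f x z)) \<partial>lborel) \<le> (\<integral>\<^sup>+x. ennreal (?e z) *
          (ennreal ((cmod (g x))\<^sup>2) + ennreal ((cmod (g (x + (1 / m) *\<^sub>R z)))\<^sup>2)) \<partial>lborel)"
      proof (rule nn_integral_mono)
        fix x
        let ?a = "cmod (g x)" and ?b = "cmod (g (x + (1 / m) *\<^sub>R z))"
        have "?a * ?b \<le> ?a\<^sup>2 + ?b\<^sup>2"
          using sum_squares_bound[of ?a ?b] mult_nonneg_nonneg[OF norm_ge_zero norm_ge_zero, of "g x" "g (x + (1 / m) *\<^sub>R z)"]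
          by linarith
        then have "?e z * (?a * ?b) \<le> ?e z * (?a\<^sup>2 + ?b\<^sup>2)" by (intro mult_left_mono) auto
        then have "norm (?f x z) \<le> ?e z * (?a\<^sup>2 + ?b\<^sup>2)" by (simp add: norm_mult)
        then have "ennreal (norm (?f x z)) \<le> ennreal (?e z * (?a\<^sup>2 + ?b\<^sup>2))" by (rule ennreal_leI)
        also have "\<dots> = ennreal (?e z) * (ennreal (?a\<^sup>2) + ennreal (?b\<^sup>2))"
          by (simp add: ennreal_mult)
        finally show "ennreal (norm (?f x z)) \<le> ennreal (?e z) * (ennreal (?a\<^sup>2) + ennreal (?b\<^sup>2))" .
      qed
      also have "\<dots> = ennreal (?e z) * (L2sq g + L2sq (\<lambda>x. g (x + (1 / m) *\<^sub>R z)))"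
        unfolding L2sq_def by (simp add: nn_integral_cmult nn_integral_add)
      finally show "(\<integral>\<^sup>+x. ennreal (norm (?f x z)) \<partial>lborel) \<le> ennreal (?e z) * (2 * L2sq g)"
        by (simp add: L2sq_translate mult_2)
    qed
    also have "\<dots> = (\<integral>\<^sup>+z. ennreal (?e z) \<partial>lborel) * (2 * L2sq g)"
      by (rule nn_integral_multc) auto
    also have "\<dots> < top"
      using fin inte' by (auto simp: ennreal_mult_less_top nn_integral_eq_integral)
    finally show "(\<integral>\<^sup>+ p. ennreal (norm (case p of (z, x) \<Rightarrow> ?f x z)) \<partial>(lborel \<Otimes>\<^sub>M lborel)) < \<infinity>" by simp
  qed measurable
  have "(LINT x|lborel. of_real (exp (- (norm x)\<^sup>2 / (2 * m\<^sup>2))) * cnj (FT \<sigma> g x) * FT \<sigma> g x) =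
      (LINT x|lborel. of_real ?K * (LINT z|lborel. of_real (?e z) * cnj (g (x + (1 / m) *\<^sub>R z))) * g x)"
    unfolding gaussian_weighted_FT[OF g \<sigma> m] inner ..
  also have "\<dots> = (LINT x|lborel. of_real ?K * (LINT z|lborel. ?f x z))"
    by (simp add: ac_simps flip: integral_mult_right_zero)
  also have "\<dots> = of_real ?K * (LINT x|lborel. LINT z|lborel. ?f x z)"
    by simp
  also have "(LINT x|lborel. LINT z|lborel. ?f x z) = (LINT z|lborel. LINT x|lborel. ?f x z)"
    by (rule lborel_pair.Fubini_integral[OF int2])
  finally show ?thesis by simp
qed

text \<open>The two sides of the rescaled Gaussian identity are passed to the limit by different
  means. On the autocorrelation side dominated convergence applies. On the transform side the
  weights increase to \<open>1\<close> and monotone convergence applies, so that finiteness of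
  \<open>L2sq (FT \<sigma> g)\<close> is part of the conclusion.\<close>

theorem Plancherel_L1_L2:
  fixes g :: "'a::euclidean_space \<Rightarrow> complex"
  assumes g: "integrable lborel g" and fin: "L2sq g < top" and \<sigma>: "\<bar>\<sigma>\<bar> = 1"
  shows "L2sq (FT \<sigma> g) = ennreal ((2 * pi) ^ DIM('a)) * L2sq g"
proof -
  note [measurable] = borel_measurable_integrable[OF g, simplified]
  let ?e = "\<lambda>z::'a. exp (- (norm z)\<^sup>2 / 2)"
  let ?K = "sqrt (2 * pi) ^ DIM('a)"
  define N where "N = enn2real (L2sq g)"
  have N: "L2sq g = ennreal N" "N \<ge> 0" using fin by (auto simp: N_def)
  define A where "A w = (LINT x|lborel. g x * cnj (g (x + w)))" for w
  have A: "Re (A w) = N - enn2real (L2sq (\<lambda>x. g (x + w) - g x)) / 2" for w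
    unfolding A_def N_def by (rule real_integral_translation_product) (use fin in auto)
  have [measurable]: "A \<in> borel_measurable borel" unfolding A_def[abs_def] by measurable
  have A_le: "\<bar>Re (A w)\<bar> \<le> N" for w
  proof -
    have "L2sq (\<lambda>x. g (x + w) - g x) \<le> 2 * L2sq (\<lambda>x. g (x + w)) + 2 * L2sq g"
      by (rule L2sq_diff_le) auto
    also have "\<dots> = ennreal (4 * N)" using N by (simp add: L2sq_translate ennreal_mult flip: distrib_right)
    finally have "enn2real (L2sq (\<lambda>x. g (x + w) - g x)) \<le> 4 * N"
      using N by (simp add: enn2real_leI)
    then show ?thesis unfolding A using enn2real_nonneg[of "L2sq (\<lambda>x. g (x + w) - g x)"] by linarith
  qed
  \<comment> \<open>Continuity of translation enters here.\<close>
  have A_lim: "(\<lambda>k. Re (A (w k))) \<longlonglongrightarrow> N" if "w \<longlonglongrightarrow> 0" for w :: "nat \<Rightarrow> 'a"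
  proof -
    have "(\<lambda>k. L2sq (\<lambda>x. g (x + w k) - g x)) \<longlonglongrightarrow> ennreal 0"
      using L2_translation_continuous[of g] fin that by (simp add: L2_translation_continuous_def)
    from tendsto_enn2real[OF this] have "(\<lambda>k. N - enn2real (L2sq (\<lambda>x. g (x + w k) - g x)) / 2) \<longlonglongrightarrow> N - 0 / 2"
      by (intro tendsto_diff tendsto_divide tendsto_const) auto
    then show ?thesis by (simp add: A)
  qed
  have inte: "integrable lborel (\<lambda>z. complex_of_real (?e z))" using integrable_gaussian_cis[of 1 0] by simp
  have inte': "integrable lborel ?e"
    using integrable_norm[OF inte] by simp
  have "complex_of_real (LINT z|lborel. ?e z) = of_real ?K"
    using integral_gaussian_cis[of 1 "0::'a"] by (simp flip: integral_of_real)
  then have e: "(LINT z|lborel. ?e z) = ?K" by (simp only: of_real_eq_iff)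
  define \<gamma> where "\<gamma> k x = exp (- (norm x)\<^sup>2 / (2 * (real (Suc k))\<^sup>2))" for k and x :: 'a
  have [measurable]: "\<gamma> k \<in> borel_measurable borel" for k unfolding \<gamma>_def by measurable
  define J where "J k = (LINT x|lborel. \<gamma> k x * (cmod (FT \<sigma> g x))\<^sup>2)" for k
  \<comment> \<open>\<open>J k\<close> is real, so the identity survives taking real parts and only
    the real part of the autocorrelation \<open>A\<close> has to converge.\<close>
  have J: "J k = ?K * (LINT z|lborel. ?e z * Re (A ((1 / Suc k) *\<^sub>R z)))" for k
  proof -
    have sq: "of_real (\<gamma> k x) * cnj (FT \<sigma> g x) * FT \<sigma> g x = complex_of_real (\<gamma> k x * (cmod (FT \<sigma> g x))\<^sup>2)" for x
      using complex_norm_square[of "FT \<sigma> g x"] by (simp add: ac_simps)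
    have "complex_of_real (J k) = of_real ?K * (LINT z|lborel. of_real (?e z) * A ((1 / Suc k) *\<^sub>R z))"
      using gaussian_weighted_FT_rescaled[OF g fin \<sigma>, of "real (Suc k)"]
      unfolding A_def J_def \<gamma>_def[symmetric] sq by (simp del: of_nat_Suc of_real_mult)
    then have "J k = Re (of_real ?K * (LINT z|lborel. of_real (?e z) * A ((1 / Suc k) *\<^sub>R z)))"
      by (metis Re_complex_of_real)
    also have "\<dots> = ?K * Re (LINT z|lborel. of_real (?e z) * A ((1 / Suc k) *\<^sub>R z))"
      by (simp only: Re_complex_of_real Im_complex_of_real times_complex.sel mult_zero_left diff_zero)
    also have "Re (LINT z|lborel. of_real (?e z) * A ((1 / Suc k) *\<^sub>R z)) =
        (LINT z|lborel. Re (of_real (?e z) * A ((1 / Suc k) *\<^sub>R z)))"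
    proof (rule integral_Re[symmetric])
      show "integrable lborel (\<lambda>z. of_real (?e z) * A ((1 / Suc k) *\<^sub>R z))"
      proof (rule Bochner_Integration.integrable_bound)
        show "integrable lborel (\<lambda>z. ?e z * (2 * N))" using inte' by simp
        have "cmod (A w) \<le> 2 * N" for w
          unfolding A_def N_def by (rule real_integral_translation_product) (use fin in auto)
        then show "AE z in lborel. norm (of_real (?e z) * A ((1 / Suc k) *\<^sub>R z)) \<le> norm (?e z * (2 * N))"
          using N(2) by (auto simp: norm_mult abs_mult)
      qed measurable
    qed
    finally show ?thesis by simp
  qed
  have "(\<lambda>k. LINT z|lborel. ?e z * Re (A ((1 / Suc k) *\<^sub>R z))) \<longlonglongrightarrow> (LINT z|lborel. ?e z * N)"
  proof (rule integral_dominated_convergence[where w="\<lambda>z. ?e z * N"])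
    show "AE z in lborel. (\<lambda>k. ?e z * Re (A ((1 / Suc k) *\<^sub>R z))) \<longlonglongrightarrow> ?e z * N"
    proof (intro AE_I2 tendsto_mult tendsto_const A_lim)
      fix z :: 'a
      have "(\<lambda>k. (1 / Suc k) *\<^sub>R z) \<longlonglongrightarrow> 0 *\<^sub>R z"
        by (intro tendsto_scaleR tendsto_const LIMSEQ_Suc[OF lim_1_over_n])
      then show "(\<lambda>k. (1 / Suc k) *\<^sub>R z) \<longlonglongrightarrow> 0" by simp
    qed
    show "AE z in lborel. norm (?e z * Re (A ((1 / Suc k) *\<^sub>R z))) \<le> ?e z * N" for k
      using A_le by (auto simp: abs_mult)
  qed (use inte' in auto)
  \<comment> \<open>One factor \<open>?K\<close> is left over from the rescaling, the other is the
    total mass of the fixed Gaussian; together they give \<open>(2 * pi) ^ DIM('a)\<close>.\<close>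
  then have "J \<longlonglongrightarrow> ?K * (?K * N)"
    unfolding J using inte' e by (intro tendsto_mult tendsto_const) simp
  also have "?K * (?K * N) = (2 * pi) ^ DIM('a) * N" 
  proof -
    have "?K * ?K = (sqrt (2 * pi) * sqrt (2 * pi)) ^ DIM('a)" by (simp only: power_mult_distrib)
    then show ?thesis by (simp add: mult.assoc[symmetric])
  qed
  finally have lim1: "(\<lambda>k. ennreal (J k)) \<longlonglongrightarrow> ennreal ((2 * pi) ^ DIM('a) * N)"
    by (rule tendsto_ennrealI)
  define B where "B = (LINT x|lborel. cmod (g x))"
  have B: "cmod (FT \<sigma> g x) \<le> B" for x unfolding B_def by (rule norm_FT_le)
  have int\<gamma>: "integrable lborel (\<gamma> k)" for k
    using integrable_norm[OF integrable_gaussian_cis[of "real (Suc k)" "0::'a"]] by (simp add: \<gamma>_def[abs_def] del: of_nat_Suc)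
  have "integrable lborel (\<lambda>x. \<gamma> k x * (cmod (FT \<sigma> g x))\<^sup>2)" for k
  proof (rule Bochner_Integration.integrable_bound)
    show "integrable lborel (\<lambda>x. \<gamma> k x * B\<^sup>2)" using int\<gamma> by simp
    show "AE x in lborel. norm (\<gamma> k x * (cmod (FT \<sigma> g x))\<^sup>2) \<le> norm (\<gamma> k x * B\<^sup>2)"
      using B by (auto simp: abs_mult intro!: AE_I2 mult_left_mono power_mono)
  qed measurable
  then have J': "ennreal (J k) = (\<integral>\<^sup>+x. ennreal (\<gamma> k x * (cmod (FT \<sigma> g x))\<^sup>2) \<partial>lborel)" for k
    unfolding J_def by (intro nn_integral_eq_integral[symmetric]) (auto simp: \<gamma>_def)
  have lim2: "(\<lambda>k. ennreal (J k)) \<longlonglongrightarrow> L2sq (FT \<sigma> g)"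
    unfolding J' L2sq_def
  proof (rule nn_integral_LIMSEQ)
    have "\<gamma> i x \<le> \<gamma> j x" if "i \<le> j" for i j x
      unfolding \<gamma>_def using that by (auto intro!: divide_left_mono power_mono)
    then show "incseq (\<lambda>k x. ennreal (\<gamma> k x * (cmod (FT \<sigma> g x))\<^sup>2))"
      by (auto simp: incseq_def le_fun_def intro!: ennreal_leI mult_right_mono)
    show "(\<lambda>k. ennreal (\<gamma> k x * (cmod (FT \<sigma> g x))\<^sup>2)) \<longlonglongrightarrow> ennreal ((cmod (FT \<sigma> g x))\<^sup>2)" for x
    proof -
      have "(\<lambda>k. exp (- (norm x)\<^sup>2 / 2 * (1 / real (Suc k))\<^sup>2)) \<longlonglongrightarrow> exp (- (norm x)\<^sup>2 / 2 * 0\<^sup>2)"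
        by (intro tendsto_intros LIMSEQ_Suc[OF lim_1_over_n])
      then have "(\<lambda>k. \<gamma> k x) \<longlonglongrightarrow> 1" by (simp add: \<gamma>_def field_simps del: of_nat_Suc)
      from tendsto_mult[OF this tendsto_const] show ?thesis by (intro tendsto_ennrealI) simp
    qed
  qed measurable
  from LIMSEQ_unique[OF lim2 lim1] show ?thesis using N by (simp add: ennreal_mult)
qed

section \<open>The Fourier transform on \<open>L\<^sup>2\<close>\<close>

definition trunc :: "real \<Rightarrow> ('a::euclidean_space \<Rightarrow> complex) \<Rightarrow> 'a \<Rightarrow> complex" where
  "trunc R h x = indicator (cball 0 R) x *\<^sub>R h x"

lemma trunc_cases: "trunc R h x = (if norm x \<le> R then h x else 0)"
  by (simp add: trunc_def indicator_def)

lemma borel_measurable_trunc [measurable]: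
  assumes [measurable]: "h \<in> borel_measurable borel"
  shows "trunc R h \<in> borel_measurable borel"
  unfolding trunc_cases[abs_def] by measurable

lemma L2sq_trunc_le: "L2sq (trunc R h) \<le> L2sq h"
  by (rule L2sq_mono) (simp add: trunc_cases)

lemma integrable_trunc:
  assumes [measurable]: "h \<in> borel_measurable borel" and "L2sq h < top"
  shows "integrable lborel (trunc R h)"
proof (rule Bochner_Integration.integrable_bound)
  have "emeasure lborel (cball (0::'a) R) < \<infinity>" by (rule emeasure_bounded_finite) simp
  then show "integrable lborel (\<lambda>x. indicator (cball 0 R) x + (cmod (h x))\<^sup>2)"
    using assms by (intro Bochner_Integration.integrable_add) (auto simp: integrable_square_iff_L2sq)
  \<comment> \<open>This puts a square-integrable function on a ball into \<open>L1\<close>: its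
    modulus is at most \<open>1\<close> plus its square, and the ball has finite measure.\<close>
  have "t \<le> 1 + t\<^sup>2" for t :: real
  proof -
    have "0 \<le> (t - 1)\<^sup>2" "0 \<le> t\<^sup>2" by simp_all
    moreover have "(t - 1)\<^sup>2 = t\<^sup>2 + 1 - 2 * t" by (simp add: power2_diff)
    ultimately show ?thesis by linarith
  qed
  then show "AE x in lborel. norm (trunc R h x) \<le> norm (indicator (cball 0 R) x + (cmod (h x))\<^sup>2)"
    by (auto simp: trunc_def indicator_def)
qed measurable

lemma trunc_tendsto:
  fixes h :: "'a::euclidean_space \<Rightarrow> complex"
  assumes [measurable]: "h \<in> borel_measurable borel" and fin: "L2sq h < top"
  shows "((\<lambda>R. L2sq (\<lambda>x. trunc R h x - h x)) \<longlongrightarrow> 0) at_top"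
proof (rule tendsto_at_topI_sequentially)
  fix X :: "nat \<Rightarrow> real" assume X: "filterlim X at_top sequentially"
  show "(\<lambda>n. L2sq (\<lambda>x. trunc (X n) h x - h x)) \<longlonglongrightarrow> 0"
  proof (rule L2sq_tendsto_0_dominated[where w=h])
    show "AE x in lborel. (\<lambda>n. trunc (X n) h x - h x) \<longlonglongrightarrow> 0"
    proof (rule AE_I2)
      fix x :: 'a
      from X have "\<forall>\<^sub>F n in sequentially. norm x \<le> X n" by (simp add: filterlim_at_top)
      then have "\<forall>\<^sub>F n in sequentially. trunc (X n) h x - h x = 0"
        by eventually_elim (simp add: trunc_cases)
      then show "(\<lambda>n. trunc (X n) h x - h x) \<longlonglongrightarrow> 0" by (rule tendsto_eventually)
    qed
  qed (use fin in \<open>auto simp: trunc_cases\<close>)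
qed

lemma ennreal_le_suminf: "d k \<le> (\<Sum>k. d k :: ennreal)"
  using sum_le_suminf[of d "{k}"] by simp

text \<open>Weighting the \<open>k\<close>-th squared increment by \<open>2 ^ k\<close> still leaves
  a sum with finite integral. Wherever that sum is a finite number \<open>M\<close>, the increments
  are at most \<open>sqrt M * (1 / sqrt 2) ^ k\<close>, so the telescoping series converges
  absolutely.\<close>

lemma L2sq_fast_Cauchy_converges_AE:
  fixes f :: "nat \<Rightarrow> 'a::euclidean_space \<Rightarrow> complex"
  assumes [measurable]: "\<And>k. f k \<in> borel_measurable borel"
    and le: "\<And>k. L2sq (\<lambda>x. f (Suc k) x - f k x) \<le> ennreal (C * (1 / 4) ^ k)" and C: "C \<ge> 0"
  shows "\<exists>u \<in> borel_measurable borel. AE x in lborel. (\<lambda>k. f k x) \<longlonglongrightarrow> u x"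
proof
  let ?u = "\<lambda>x. lim (\<lambda>k. f k x)"
  show "?u \<in> borel_measurable borel" by measurable
  let ?d = "\<lambda>k x. ennreal (2 ^ k * (cmod (f (Suc k) x - f k x))\<^sup>2)"
  have "(\<integral>\<^sup>+x. (\<Sum>k. ?d k x) \<partial>lborel) = (\<Sum>k. \<integral>\<^sup>+x. ?d k x \<partial>lborel)"
    by (rule nn_integral_suminf) measurable
  also have "\<dots> \<le> (\<Sum>k. ennreal (C * (1 / 2) ^ k))"
  proof (intro suminf_le)
    fix k
    have "(\<integral>\<^sup>+x. ?d k x \<partial>lborel) = ennreal (2 ^ k) * L2sq (\<lambda>x. f (Suc k) x - f k x)"
      unfolding L2sq_def by (subst nn_integral_cmult[symmetric]) (auto simp: ennreal_mult)
    also have "\<dots> \<le> ennreal (2 ^ k) * ennreal (C * (1 / 4) ^ k)"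
      by (intro mult_left_mono le) auto
    also have "\<dots> = ennreal (C * (1 / 2) ^ k)"
    proof -
      have "(2::real) ^ k * (1 / 4) ^ k = (1 / 2) ^ k"
        unfolding power_mult_distrib[symmetric] by simp
      then have "2 ^ k * (C * (1 / 4) ^ k) = C * (1 / 2) ^ k"
        by (metis mult.left_commute)
      then show ?thesis by (metis ennreal_mult' zero_le_numeral zero_le_power)
    qed
    finally show "(\<integral>\<^sup>+x. ?d k x \<partial>lborel) \<le> ennreal (C * (1 / 2) ^ k)" .
  qed auto
  also have "\<dots> < top"
  proof -
    have "summable (\<lambda>k. C * (1 / 2) ^ k :: real)" by (intro summable_mult summable_geometric) simp
    then have "(\<Sum>k. ennreal (C * (1 / 2) ^ k)) = ennreal (\<Sum>k. C * (1 / 2) ^ k)"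
      using C by (intro suminf_ennreal2) auto
    then show ?thesis by simp
  qed
  finally have "AE x in lborel. (\<Sum>k. ?d k x) \<noteq> \<infinity>"
    by (intro nn_integral_PInf_AE) auto
  then show "AE x in lborel. (\<lambda>k. f k x) \<longlonglongrightarrow> ?u x"
  proof eventually_elim
    case (elim x)
    define M where "M = enn2real (\<Sum>k. ?d k x)"
    have M: "(\<Sum>k. ?d k x) = ennreal M" using elim unfolding M_def by (simp add: ennreal_enn2real_if)
    have bound: "cmod (f (Suc k) x - f k x) \<le> sqrt M * (1 / sqrt 2) ^ k" for k
    proof -
      have "?d k x \<le> (\<Sum>k. ?d k x)"
        by (rule ennreal_le_suminf)
      then have "2 ^ k * (cmod (f (Suc k) x - f k x))\<^sup>2 \<le> M"
        unfolding M by (subst (asm) ennreal_le_iff) (auto simp: M_def)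
      then have "sqrt (2 ^ k * (cmod (f (Suc k) x - f k x))\<^sup>2) \<le> sqrt M" by simp
      then show ?thesis
        by (simp add: real_sqrt_mult real_sqrt_power power_divide field_simps)
    qed
    have "summable (\<lambda>k. f (Suc k) x - f k x)"
      by (rule summable_comparison_test'[where g="\<lambda>k. sqrt M * (1 / sqrt 2) ^ k" and N=0])
        (use bound in \<open>auto intro!: summable_mult summable_geometric\<close>)
    then have "(\<lambda>n. f 0 x + (\<Sum>k<n. f (Suc k) x - f k x)) \<longlonglongrightarrow> f 0 x + (\<Sum>k. f (Suc k) x - f k x)"
      by (intro tendsto_add tendsto_const summable_LIMSEQ)
    moreover have "f 0 x + (\<Sum>k<n. f (Suc k) x - f k x) = f n x" for n
      using sum_lessThan_telescope[of "\<lambda>n. f n x" n] by simp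
    ultimately have "convergent (\<lambda>n. f n x)"
      by (auto simp: convergent_def)
    then show ?case by (simp add: convergent_LIMSEQ_iff)
  qed
qed

text \<open>A relation rather than a function: an \<open>L2\<close> limit is determined only up to
  null sets, and \<open>L2_lim\<close> picks one by \<open>SOME\<close>. Sums and multiples of
  limits can then be stated without exceptional sets.\<close>

definition L2_limit :: "(real \<Rightarrow> 'a::euclidean_space \<Rightarrow> complex) \<Rightarrow> ('a \<Rightarrow> complex) \<Rightarrow> bool" where
  "L2_limit F u \<longleftrightarrow> u \<in> borel_measurable borel \<and> L2sq u < top \<and>
     ((\<lambda>R. L2sq (\<lambda>x. F R x - u x)) \<longlongrightarrow> 0) at_top"

lemma L2_limit_unique:
  assumes [measurable]: "\<And>R. F R \<in> borel_measurable borel" and u: "L2_limit F u" and v: "L2_limit F v"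
  shows "AE x in lborel. u x = v x"
proof -
  from u v have [measurable]: "u \<in> borel_measurable borel" "v \<in> borel_measurable borel"
    by (auto simp: L2_limit_def)
  have "((\<lambda>R. 2 * L2sq (\<lambda>x. F R x - u x) + 2 * L2sq (\<lambda>x. F R x - v x)) \<longlongrightarrow> 0 + 0) at_top"
    using u v by (intro tendsto_add ennreal_tendsto_cmult_0) (auto simp: L2_limit_def)
  moreover have "L2sq (\<lambda>x. u x - v x) \<le> 2 * L2sq (\<lambda>x. F R x - u x) + 2 * L2sq (\<lambda>x. F R x - v x)" for R
    using L2sq_triangle[of u "F R" v] by (simp add: L2sq_diff_commute[of u])
  ultimately have "L2sq (\<lambda>x. u x - v x) \<le> 0 + 0"
    by (intro tendsto_lowerbound) auto
  then show ?thesis by (simp add: L2sq_eq_0_iff)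
qed

lemma L2_limit_add:
  assumes [measurable]: "\<And>R. F R \<in> borel_measurable borel" "\<And>R. G R \<in> borel_measurable borel"
    and u: "L2_limit F u" and v: "L2_limit G v"
  shows "L2_limit (\<lambda>R x. F R x + G R x) (\<lambda>x. u x + v x)"
proof -
  from u v have [measurable]: "u \<in> borel_measurable borel" "v \<in> borel_measurable borel"
    by (auto simp: L2_limit_def)
  have lim: "((\<lambda>R. 2 * L2sq (\<lambda>x. F R x - u x) + 2 * L2sq (\<lambda>x. G R x - v x)) \<longlongrightarrow> 0) at_top"
  proof -
    have "((\<lambda>R. 2 * L2sq (\<lambda>x. F R x - u x) + 2 * L2sq (\<lambda>x. G R x - v x)) \<longlongrightarrow> 0 + 0) at_top"
      using u v by (intro tendsto_add ennreal_tendsto_cmult_0) (auto simp: L2_limit_def)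
    then show ?thesis by simp
  qed
  have "((\<lambda>R. L2sq (\<lambda>x. F R x + G R x - (u x + v x))) \<longlongrightarrow> 0) at_top"
  proof (rule ennreal_tendsto_0_le[OF lim])
    show "L2sq (\<lambda>x. F R x + G R x - (u x + v x)) \<le>
        2 * L2sq (\<lambda>x. F R x - u x) + 2 * L2sq (\<lambda>x. G R x - v x)" for R
      using L2sq_add_le[of "\<lambda>x. F R x - u x" "\<lambda>x. G R x - v x"] by (simp add: algebra_simps)
  qed
  with u v L2sq_finite_add[of u v] show ?thesis by (auto simp: L2_limit_def)
qed

lemma L2_limit_cmult:
  assumes [measurable]: "\<And>R. F R \<in> borel_measurable borel" and u: "L2_limit F u"
  shows "L2_limit (\<lambda>R x. c * F R x) (\<lambda>x. c * u x)"
proof -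
  from u have [measurable]: "u \<in> borel_measurable borel" by (auto simp: L2_limit_def)
  have eq: "L2sq (\<lambda>x. c * F R x - c * u x) = ennreal ((cmod c)\<^sup>2) * L2sq (\<lambda>x. F R x - u x)" for R
    using L2sq_cmult[of "\<lambda>x. F R x - u x" c] by (simp add: algebra_simps)
  have "((\<lambda>R. L2sq (\<lambda>x. c * F R x - c * u x)) \<longlongrightarrow> 0) at_top"
    unfolding eq using u by (intro ennreal_tendsto_cmult_0) (auto simp: L2_limit_def)
  with u show ?thesis by (auto simp: L2_limit_def L2sq_cmult ennreal_mult_less_top)
qed

section \<open>Existence, uniqueness, linearity and inversion of the L2 transform\<close>

definition L2_FT :: "real \<Rightarrow> ('a::euclidean_space \<Rightarrow> complex) \<Rightarrow> ('a \<Rightarrow> complex) \<Rightarrow> bool" where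
  "L2_FT \<sigma> h u \<longleftrightarrow> L2_limit (\<lambda>R. FT \<sigma> (trunc R h)) u"

text \<open>Plancherel's identity makes the transforms of truncations Cauchy, with the tail of
  \<open>h\<close> at the smaller radius as modulus. A sequence of radii with fast decaying tails
  gives an almost everywhere limit \<open>u\<close>, and Fatou's lemma then controls the distance to
  \<open>u\<close> for every real radius.\<close>

lemma L2_FT_exists:
  fixes h :: "'a::euclidean_space \<Rightarrow> complex"
  assumes [measurable]: "h \<in> borel_measurable borel" and fin: "L2sq h < top" and \<sigma>: "\<bar>\<sigma>\<bar> = 1"
  shows "\<exists>u. L2_FT \<sigma> h u"
proof -
  let ?c = "(2 * pi) ^ DIM('a)"
  define tail where "tail R = L2sq (\<lambda>x. trunc R h x - h x)" for R
  have tail: "(tail \<longlongrightarrow> 0) at_top" unfolding tail_def[abs_def] by (rule trunc_tendsto) (use fin in auto)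
  \<comment> \<open>The rate \<open>(1 / 4) ^ k\<close> is the one required for almost everywhere
    convergence; \<open>R \<ge> real k\<close> makes the chosen radii eventually exceed any fixed
    one.\<close>
  have "\<exists>R. R \<ge> real k \<and> tail R < ennreal ((1 / 4) ^ k)" for k
  proof -
    have "\<forall>\<^sub>F R in at_top. tail R < ennreal ((1 / 4) ^ k)"
      by (rule order_tendstoD(2)[OF tail]) simp
    then have "\<forall>\<^sub>F R in at_top. tail R < ennreal ((1 / 4) ^ k) \<and> R \<ge> real k"
      by (intro eventually_conj eventually_ge_at_top)
    then show ?thesis using eventually_happens'[OF trivial_limit_at_top_linorder] by blast
  qed
  then obtain r where r: "\<And>k. r k \<ge> real k" "\<And>k. tail (r k) < ennreal ((1 / 4) ^ k)" by metis
  let ?T = "\<lambda>R. FT \<sigma> (trunc R h)"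
  have diff: "L2sq (\<lambda>x. ?T S x - ?T R x) = ennreal ?c * L2sq (\<lambda>x. trunc S h x - trunc R h x)" for R S
  proof -
    have "(\<lambda>x. ?T S x - ?T R x) = FT \<sigma> (\<lambda>x. trunc S h x - trunc R h x)"
      using fin by (intro ext FT_diff[symmetric] integrable_trunc) auto
    then show ?thesis
      using fin by (simp only:) (intro Plancherel_L1_L2 \<sigma> Bochner_Integration.integrable_diff integrable_trunc
        L2sq_finite_diff; auto intro: le_less_trans[OF L2sq_trunc_le])
  qed
  have diff1: "L2sq (\<lambda>x. ?T S x - ?T R x) \<le> ennreal ?c * tail R" if "R \<le> S" for R S
    unfolding diff tail_def by (intro mult_left_mono L2sq_mono) (use that in \<open>auto simp: trunc_cases\<close>)
  have diff2: "L2sq (\<lambda>x. ?T S x - ?T R x) \<le> ennreal ?c * (tail R + tail S)" for R S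
  proof (cases "R \<le> S")
    case True
    show ?thesis by (rule order_trans[OF diff1[OF True]]) (intro mult_left_mono; simp)
  next
    case False
    then show ?thesis
      by (subst L2sq_diff_commute, intro order_trans[OF diff1[of S R]]) (auto intro!: mult_left_mono)
  qed
  have "\<exists>u \<in> borel_measurable borel. AE x in lborel. (\<lambda>k. ?T (r k) x) \<longlonglongrightarrow> u x"
  proof (rule L2sq_fast_Cauchy_converges_AE)
    fix k
    have "tail (r (Suc k)) \<le> ennreal ((1 / 4) ^ Suc k)" using r(2)[of "Suc k"] by simp
    also have "\<dots> \<le> ennreal ((1 / 4) ^ k)" by (intro ennreal_leI power_decreasing) auto
    finally have "tail (r k) + tail (r (Suc k)) \<le> ennreal ((1 / 4) ^ k) + ennreal ((1 / 4) ^ k)"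
      using r(2)[of k] by (intro add_mono) auto
    then have "L2sq (\<lambda>x. ?T (r (Suc k)) x - ?T (r k) x) \<le>
        ennreal ?c * (ennreal ((1 / 4) ^ k) + ennreal ((1 / 4) ^ k))"
      by (intro order_trans[OF diff2] mult_left_mono) auto
    also have "\<dots> = ennreal (2 * ?c * (1 / 4) ^ k)"
      by (simp flip: ennreal_plus ennreal_mult)
    finally show "L2sq (\<lambda>x. ?T (r (Suc k)) x - ?T (r k) x) \<le> ennreal (2 * ?c * (1 / 4) ^ k)" .
  qed auto
  then obtain u where [measurable]: "u \<in> borel_measurable borel"
    and u: "AE x in lborel. (\<lambda>k. ?T (r k) x) \<longlonglongrightarrow> u x" by blast
  have le: "L2sq (\<lambda>x. ?T R x - u x) \<le> ennreal ?c * tail R" for R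
  proof -
    \<comment> \<open>The squared distance to \<open>u\<close> is the pointwise limit of the squared
      distances to \<open>?T (r k)\<close>, and these have integral at most
      \<open>?c * tail R\<close> as soon as \<open>r k\<close> is at least \<open>R\<close>.\<close>
    have "L2sq (\<lambda>x. ?T R x - u x) = (\<integral>\<^sup>+x. liminf (\<lambda>k. ennreal ((cmod (?T (r k) x - ?T R x))\<^sup>2)) \<partial>lborel)"
      unfolding L2sq_def
    proof (rule nn_integral_cong_AE)
      from u show "AE x in lborel. ennreal ((cmod (?T R x - u x))\<^sup>2) =
          liminf (\<lambda>k. ennreal ((cmod (?T (r k) x - ?T R x))\<^sup>2))"
      proof eventually_elim
        case (elim x)
        have "(\<lambda>k. ennreal ((cmod (?T (r k) x - ?T R x))\<^sup>2)) \<longlonglongrightarrow> ennreal ((cmod (u x - ?T R x))\<^sup>2)"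
          by (intro tendsto_intros elim)
        from lim_imp_Liminf[OF _ this] show ?case by (simp add: norm_minus_commute)
      qed
    qed
    also have "\<dots> \<le> liminf (\<lambda>k. \<integral>\<^sup>+x. ennreal ((cmod (?T (r k) x - ?T R x))\<^sup>2) \<partial>lborel)"
      by (rule nn_integral_liminf) measurable
    also have "\<dots> \<le> ennreal ?c * tail R"
    proof (rule Liminf_le)
      obtain K :: nat where K: "R \<le> real K" using real_arch_simple by blast
      have "R \<le> r k" if "k \<ge> K" for k using r(1)[of k] K that by (meson of_nat_mono order_trans)
      then show "\<forall>\<^sub>F k in sequentially. (\<integral>\<^sup>+x. ennreal ((cmod (?T (r k) x - ?T R x))\<^sup>2) \<partial>lborel) \<le> ennreal ?c * tail R"
        using diff1 unfolding L2sq_def by (auto simp: eventually_sequentially)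
    qed simp
    finally show ?thesis .
  qed
  have lim: "((\<lambda>R. ennreal ?c * tail R) \<longlongrightarrow> 0) at_top"
    by (rule ennreal_tendsto_cmult_0[OF tail]) simp
  have "L2sq u < top"
  proof -
    \<comment> \<open>A ball of negative radius is empty. The bound just proved, taken at radius
      \<open>-1\<close>, is therefore a bound on the norm of \<open>u\<close> itself.\<close>
    have "trunc (-1) h = (\<lambda>_. 0)" by (auto simp: trunc_cases fun_eq_iff dest: order_trans[OF norm_ge_zero])
    then have "L2sq u \<le> ennreal ?c * L2sq h"
      using le[of "-1"] by (simp add: tail_def FT_def L2sq_uminus)
    also have "\<dots> < top" using fin by (simp add: ennreal_mult_less_top)
    finally show ?thesis .
  qed
  with ennreal_tendsto_0_le[OF lim le] have "L2_FT \<sigma> h u"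
    by (auto simp: L2_FT_def L2_limit_def)
  then show ?thesis by blast
qed

lemma L2_FT_unique:
  assumes [measurable]: "h \<in> borel_measurable borel" and "L2_FT \<sigma> h u" "L2_FT \<sigma> h v"
  shows "AE x in lborel. u x = v x"
  by (rule L2_limit_unique[of "\<lambda>R. FT \<sigma> (trunc R h)"]) (use assms in \<open>auto simp: L2_FT_def\<close>)

lemma L2_FT_measurable: "L2_FT \<sigma> h u \<Longrightarrow> u \<in> borel_measurable borel"
  by (simp add: L2_FT_def L2_limit_def)

lemma L2_FT_finite: "L2_FT \<sigma> h u \<Longrightarrow> L2sq u < top"
  by (simp add: L2_FT_def L2_limit_def)

text \<open>The additional factor 2 is the loss in the triangle inequality for squares. The bound
  serves to carry \<open>L2\<close> convergence through the transform, for which any constant is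
  good enough.\<close>

lemma L2_FT_bound:
  fixes h :: "'a::euclidean_space \<Rightarrow> complex"
  assumes [measurable]: "h \<in> borel_measurable borel" and fin: "L2sq h < top" and \<sigma>: "\<bar>\<sigma>\<bar> = 1"
    and u: "L2_FT \<sigma> h u"
  shows "L2sq u \<le> ennreal (2 * (2 * pi) ^ DIM('a)) * L2sq h"
proof -
  have [measurable]: "u \<in> borel_measurable borel" using u by (rule L2_FT_measurable)
  let ?N = "ennreal (2 * (2 * pi) ^ DIM('a)) * L2sq h"
  let ?T = "\<lambda>R. FT \<sigma> (trunc R h)"
  have le: "L2sq u \<le> 2 * L2sq (\<lambda>x. ?T R x - u x) + ?N" for R
  proof -
    have "L2sq u \<le> 2 * L2sq (\<lambda>x. ?T R x - u x) + 2 * L2sq (?T R)"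
      using L2sq_add_le[of "\<lambda>x. u x - ?T R x" "?T R"] by (simp add: L2sq_diff_commute[of u])
    also have "L2sq (?T R) = ennreal ((2 * pi) ^ DIM('a)) * L2sq (trunc R h)"
      using fin \<sigma> by (intro Plancherel_L1_L2 integrable_trunc) (auto intro: le_less_trans[OF L2sq_trunc_le])
    also have "2 * (ennreal ((2 * pi) ^ DIM('a)) * L2sq (trunc R h)) \<le> ?N"
      using mult_left_mono[OF L2sq_trunc_le[of R h], of "ennreal (2 * (2 * pi) ^ DIM('a))"]
      by (simp add: ennreal_mult mult.assoc)
    finally show ?thesis by (simp add: add_left_mono)
  qed
  have "((\<lambda>R. 2 * L2sq (\<lambda>x. ?T R x - u x) + ?N) \<longlongrightarrow> 0 + ?N) at_top"
    using u by (intro tendsto_add tendsto_const ennreal_tendsto_cmult_0) (auto simp: L2_FT_def L2_limit_def)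
  with le have "L2sq u \<le> 0 + ?N" by (intro tendsto_lowerbound) auto
  then show ?thesis by simp
qed

lemma L2_FT_add:
  assumes [measurable]: "h \<in> borel_measurable borel" "k \<in> borel_measurable borel"
    and "L2sq h < top" "L2sq k < top" and u: "L2_FT \<sigma> h u" "L2_FT \<sigma> k v"
  shows "L2_FT \<sigma> (\<lambda>x. h x + k x) (\<lambda>x. u x + v x)"
proof -
  have "(\<lambda>R. FT \<sigma> (trunc R (\<lambda>x. h x + k x))) = (\<lambda>R x. FT \<sigma> (trunc R h) x + FT \<sigma> (trunc R k) x)"
  proof (intro ext)
    fix R x
    have "trunc R (\<lambda>x. h x + k x) = (\<lambda>x. trunc R h x + trunc R k x)" by (auto simp: trunc_cases fun_eq_iff)
    then show "FT \<sigma> (trunc R (\<lambda>x. h x + k x)) x = FT \<sigma> (trunc R h) x + FT \<sigma> (trunc R k) x"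
      using assms by (simp add: FT_add integrable_trunc)
  qed
  with u show ?thesis unfolding L2_FT_def by (auto intro!: L2_limit_add)
qed

lemma L2_FT_cmult:
  assumes [measurable]: "h \<in> borel_measurable borel" and u: "L2_FT \<sigma> h u"
  shows "L2_FT \<sigma> (\<lambda>x. c * h x) (\<lambda>x. c * u x)"
proof -
  have "(\<lambda>R. FT \<sigma> (trunc R (\<lambda>x. c * h x))) = (\<lambda>R x. c * FT \<sigma> (trunc R h) x)"
  proof (intro ext)
    fix R x
    have "trunc R (\<lambda>x. c * h x) = (\<lambda>x. c * trunc R h x)" by (auto simp: trunc_cases fun_eq_iff)
    then show "FT \<sigma> (trunc R (\<lambda>x. c * h x)) x = c * FT \<sigma> (trunc R h) x" by (simp add: FT_cmult)
  qed
  with u show ?thesis unfolding L2_FT_def by (auto intro!: L2_limit_cmult)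
qed

lemma L2sq_finite_cmult:
  assumes "f \<in> borel_measurable borel" "L2sq f < top"
  shows "L2sq (\<lambda>x. c * f x) < top"
  using assms by (simp add: L2sq_cmult ennreal_mult_less_top)

lemma L2_FT_zero: "L2_FT \<sigma> (\<lambda>_. 0) (\<lambda>_. 0)"
  by (simp add: L2_FT_def L2_limit_def FT_def trunc_cases L2sq_def)

text \<open>Finiteness of the norm is carried along because \<open>L2_FT_add\<close> asks for it at
  every step of the induction.\<close>

lemma L2_FT_sum:
  fixes h :: "'i \<Rightarrow> 'a::euclidean_space \<Rightarrow> complex"
  assumes "finite I" and h: "\<And>i. i \<in> I \<Longrightarrow> h i \<in> borel_measurable borel" "\<And>i. i \<in> I \<Longrightarrow> L2sq (h i) < top"
    "\<And>i. i \<in> I \<Longrightarrow> L2_FT \<sigma> (h i) (u i)"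
  shows "L2_FT \<sigma> (\<lambda>x. \<Sum>i\<in>I. h i x) (\<lambda>x. \<Sum>i\<in>I. u i x) \<and> L2sq (\<lambda>x. \<Sum>i\<in>I. h i x) < top"
  using assms
proof (induction I rule: finite_induct)
  case empty
  show ?case using L2_FT_zero by (simp add: L2sq_def)
next
  case (insert i I)
  have m: "(\<lambda>x. \<Sum>i\<in>I. h i x) \<in> borel_measurable borel"
    using insert by (intro borel_measurable_sum) auto
  have "L2_FT \<sigma> (\<lambda>x. h i x + (\<Sum>i\<in>I. h i x)) (\<lambda>x. u i x + (\<Sum>i\<in>I. u i x))"
    by (rule L2_FT_add) (use insert m in simp_all)
  moreover have "L2sq (\<lambda>x. h i x + (\<Sum>i\<in>I. h i x)) < top"
    by (rule L2sq_finite_add) (use insert m in simp_all)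
  ultimately show ?case using insert(1,2) by simp
qed

text \<open>Expanding both squares, Plancherel's identity and adjointness make them equal.  Since the factor
  \<open>1 / c\<close> does not depend on the truncation, inversion in \<open>L\<^sup>2\<close> follows by a limit.\<close>

lemma adjoint_L1_L2:
  fixes g h :: "'a::euclidean_space \<Rightarrow> complex"
  assumes g: "integrable lborel g" and h: "integrable lborel h" and fin: "L2sq g < top" "L2sq h < top"
  defines "c \<equiv> (2 * pi) ^ DIM('a)"
  shows "L2sq (\<lambda>x. of_real (1 / c) * FT (-1) g x - h x) =
    ennreal (1 / c) * L2sq (\<lambda>x. g x - FT 1 h x)"
proof -
  note [measurable] = borel_measurable_integrable[OF g, simplified] borel_measurable_integrable[OF h, simplified]
  have c: "c > 0" by (simp add: c_def)
  have fin': "L2sq (FT (-1) g) < top" "L2sq (FT 1 h) < top"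
    using fin g h by (simp_all add: Plancherel_L1_L2 ennreal_mult_less_top)
  have ex: "(LINT x|lborel. (cmod (a x - b x))\<^sup>2) =
      (LINT x|lborel. (cmod (a x))\<^sup>2) + (LINT x|lborel. (cmod (b x))\<^sup>2) - 2 * Re (LINT x|lborel. a x * cnj (b x))"
    if [measurable]: "a \<in> borel_measurable borel" "b \<in> borel_measurable borel"
      and ab: "L2sq a < top" "L2sq b < top" and int: "integrable lborel (\<lambda>x. a x * cnj (b x))"
    for a b :: "'a \<Rightarrow> complex"
  proof -
    have key: "(cmod (z - w))\<^sup>2 = (cmod z)\<^sup>2 + (cmod w)\<^sup>2 - 2 * Re (z * cnj w)" for z w
      by (simp add: cmod_power2) (simp add: power2_eq_square algebra_simps)
    have "integrable lborel (\<lambda>x. (cmod (a x))\<^sup>2)" "integrable lborel (\<lambda>x. (cmod (b x))\<^sup>2)"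
      using ab by (simp_all add: integrable_square_iff_L2sq)
    moreover have "integrable lborel (\<lambda>x. Re (a x * cnj (b x)))" using int by (rule integrable_Re)
    ultimately show ?thesis
      unfolding key integral_Re[OF int, symmetric] by (simp del: times_complex.sel)
  qed
  have N: "L2sq a = ennreal (LINT x|lborel. (cmod (a x))\<^sup>2)" if "a \<in> borel_measurable borel" "L2sq a < top"
    for a :: "'a \<Rightarrow> complex"
    using that by (intro L2sq_eq_integral) (simp add: integrable_square_iff_L2sq)
  have P: "(LINT x|lborel. (cmod (FT \<sigma> a x))\<^sup>2) = c * (LINT x|lborel. (cmod (a x))\<^sup>2)"
    if a: "integrable lborel a" "L2sq a < top" and \<sigma>: "\<bar>\<sigma>\<bar> = 1" for a :: "'a \<Rightarrow> complex" and \<sigma>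
  proof -
    have [measurable]: "a \<in> borel_measurable borel" using borel_measurable_integrable[OF a(1)] by simp
    have "L2sq (FT \<sigma> a) = ennreal c * L2sq a" unfolding c_def by (rule Plancherel_L1_L2[OF a \<sigma>])
    moreover from this a(2) have "L2sq (FT \<sigma> a) < top" by (simp add: ennreal_mult_less_top)
    ultimately show ?thesis using c N[of a] N[of "FT \<sigma> a"] a(2) by (simp add: ennreal_mult[symmetric])
  qed
  have bnd: "integrable lborel (\<lambda>x. a x * FT \<sigma> b x)"
    if a: "integrable lborel a" and [measurable]: "b \<in> borel_measurable borel" for a b :: "'a \<Rightarrow> complex" and \<sigma>
  proof (rule Bochner_Integration.integrable_bound)
    note [measurable] = borel_measurable_integrable[OF a, simplified]
    show "integrable lborel (\<lambda>x. of_real (LINT x|lborel. cmod (b x)) * a x)" using a by simp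
    show "AE x in lborel. norm (a x * FT \<sigma> b x) \<le> norm (of_real (LINT x|lborel. cmod (b x)) * a x)"
      using norm_FT_le[of \<sigma> b] by (auto simp: norm_mult mult.commute intro!: AE_I2 mult_left_mono)
    show "(\<lambda>x. a x * FT \<sigma> b x) \<in> borel_measurable lborel" by measurable
  qed
  have i1: "integrable lborel (\<lambda>x. FT (-1) g x * cnj (h x))"
    by (subst mult.commute, rule bnd) (use h in auto)
  have i2: "integrable lborel (\<lambda>x. g x * cnj (FT 1 h x))"
    unfolding cnj_FT by (rule bnd[OF g]) simp
  \<comment> \<open>Conjugation reverses the sign in the kernel, so the multiplication formula
    applied to \<open>g\<close> and the conjugate of \<open>h\<close> is the adjointness of the
    forward and inverse transforms.\<close>
  have "(LINT x|lborel. g x * FT (-1) (\<lambda>x. cnj (h x)) x) = (LINT x|lborel. FT (-1) g x * cnj (h x))"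
    by (rule FT_multiplication_formula) (use g h in auto)
  then have adj: "(LINT x|lborel. FT (-1) g x * cnj (h x)) = (LINT x|lborel. g x * cnj (FT 1 h x))"
    by (simp add: cnj_FT)
  let ?I = "Re (LINT x|lborel. g x * cnj (FT 1 h x))"
  let ?G = "LINT x|lborel. (cmod (g x))\<^sup>2" and ?H = "LINT x|lborel. (cmod (h x))\<^sup>2"
  have "(LINT x|lborel. (cmod (of_real (1 / c) * FT (-1) g x - h x))\<^sup>2) =
      (1 / c)\<^sup>2 * (c * ?G) + ?H - 2 * (1 / c) * ?I"
  proof (subst ex)
    show "integrable lborel (\<lambda>x. of_real (1 / c) * FT (-1) g x * cnj (h x))"
      using i1 by (simp add: mult.assoc)
    have "(LINT x|lborel. of_real (1 / c) * FT (-1) g x * cnj (h x)) =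
        of_real (1 / c) * (LINT x|lborel. g x * cnj (FT 1 h x))"
      unfolding mult.assoc adj[symmetric] by simp
    moreover have "(LINT x|lborel. (cmod (of_real (1 / c) * FT (-1) g x))\<^sup>2) = (1 / c)\<^sup>2 * (c * ?G)"
      using P[OF g fin(1), of "-1"] by (simp add: norm_mult power_mult_distrib norm_divide power_divide)
    ultimately show "(LINT x|lborel. (cmod (of_real (1 / c) * FT (-1) g x))\<^sup>2) + ?H -
        2 * Re (LINT x|lborel. of_real (1 / c) * FT (-1) g x * cnj (h x)) =
        (1 / c)\<^sup>2 * (c * ?G) + ?H - 2 * (1 / c) * ?I"
      by (simp only: Re_complex_of_real Im_complex_of_real times_complex.sel mult_zero_left diff_zero mult.assoc)
  qed (use fin fin' in \<open>auto intro: L2sq_finite_cmult simp del: of_real_divide\<close>)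
  \<comment> \<open>The factor \<open>c\<close> from Plancherel's identity cancels one of the two
    factors \<open>1 / c\<close>, which leaves a single \<open>1 / c\<close> in front of the other
    square.\<close>
  also have "\<dots> = 1 / c * (?G + c * ?H - 2 * ?I)"
    using c by (simp add: field_simps power2_eq_square)
  also have "?G + c * ?H - 2 * ?I = (LINT x|lborel. (cmod (g x - FT 1 h x))\<^sup>2)"
    using P[OF h fin(2), of 1] i2 fin fin' by (subst ex) auto
  finally have "(LINT x|lborel. (cmod (of_real (1 / c) * FT (-1) g x - h x))\<^sup>2) =
      1 / c * (LINT x|lborel. (cmod (g x - FT 1 h x))\<^sup>2)" .
  moreover have "L2sq (\<lambda>x. of_real (1 / c) * FT (-1) g x - h x) < top" "L2sq (\<lambda>x. g x - FT 1 h x) < top"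
    using fin fin' by (auto intro!: L2sq_finite_diff L2sq_finite_cmult simp del: of_real_divide)
  ultimately show ?thesis
    using c N[of "\<lambda>x. of_real (1 / c) * FT (-1) g x - h x"] N[of "\<lambda>x. g x - FT 1 h x"]
    by (simp add: ennreal_mult[symmetric] del: of_real_divide)
qed

text \<open>Truncating \<open>u\<close> and \<open>h\<close> at the same radius makes both
  integrable, so \<open>adjoint_L1_L2\<close> applies to them. It turns the error of the inverse
  into the distance between \<open>trunc R u\<close> and \<open>FT 1 (trunc R h)\<close>, both of
  which tend to \<open>u\<close>.\<close>

lemma L2_FT_inversion:
  fixes h :: "'a::euclidean_space \<Rightarrow> complex"
  assumes [measurable]: "h \<in> borel_measurable borel" and fin: "L2sq h < top" and u: "L2_FT 1 h u"
  shows "L2_FT (-1) (\<lambda>x. of_real (1 / (2 * pi) ^ DIM('a)) * u x) h"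
proof -
  let ?c = "(2 * pi) ^ DIM('a)"
  have [measurable]: "u \<in> borel_measurable borel" using u by (rule L2_FT_measurable)
  have finu: "L2sq u < top" using u by (rule L2_FT_finite)
  let ?F = "\<lambda>R x. of_real (1 / ?c) * FT (-1) (trunc R u) x"
  have le: "L2sq (\<lambda>x. ?F R x - h x) \<le> ennreal (2 / ?c) *
      (2 * L2sq (\<lambda>x. trunc R u x - u x) + 2 * L2sq (\<lambda>x. FT 1 (trunc R h) x - u x)) +
      2 * L2sq (\<lambda>x. trunc R h x - h x)" for R
  proof -
    have "L2sq (\<lambda>x. ?F R x - h x) \<le> 2 * L2sq (\<lambda>x. ?F R x - trunc R h x) + 2 * L2sq (\<lambda>x. trunc R h x - h x)"
      by (rule L2sq_triangle) measurable
    also have "L2sq (\<lambda>x. ?F R x - trunc R h x) = ennreal (1 / ?c) * L2sq (\<lambda>x. trunc R u x - FT 1 (trunc R h) x)"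
      by (rule adjoint_L1_L2) (use fin finu in \<open>auto intro: integrable_trunc le_less_trans[OF L2sq_trunc_le]\<close>)
    also have "L2sq (\<lambda>x. trunc R u x - FT 1 (trunc R h) x) \<le>
        2 * L2sq (\<lambda>x. trunc R u x - u x) + 2 * L2sq (\<lambda>x. FT 1 (trunc R h) x - u x)"
      using L2sq_triangle[of "trunc R u" u "FT 1 (trunc R h)"] by (simp add: L2sq_diff_commute[of u])
    finally have "L2sq (\<lambda>x. ?F R x - h x) \<le> 2 * (ennreal (1 / ?c) *
        (2 * L2sq (\<lambda>x. trunc R u x - u x) + 2 * L2sq (\<lambda>x. FT 1 (trunc R h) x - u x))) +
        2 * L2sq (\<lambda>x. trunc R h x - h x)"
      by (simp add: add_right_mono mult_left_mono)
    moreover have "ennreal (2 / ?c) = 2 * ennreal (1 / ?c)"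
      using ennreal_mult'[of 2 "1 / ?c"] by simp
    ultimately show ?thesis by (simp only: mult.assoc)
  qed
  have "((\<lambda>R. ennreal (2 / ?c) *
      (2 * L2sq (\<lambda>x. trunc R u x - u x) + 2 * L2sq (\<lambda>x. FT 1 (trunc R h) x - u x)) +
      2 * L2sq (\<lambda>x. trunc R h x - h x)) \<longlongrightarrow> 0) at_top"
  proof -
    have "((\<lambda>R. 2 * L2sq (\<lambda>x. trunc R u x - u x) + 2 * L2sq (\<lambda>x. FT 1 (trunc R h) x - u x)) \<longlongrightarrow> 0 + 0) at_top"
      using u finu by (intro tendsto_add ennreal_tendsto_cmult_0 trunc_tendsto) (auto simp: L2_FT_def L2_limit_def)
    then have "((\<lambda>R. ennreal (2 / ?c) *
      (2 * L2sq (\<lambda>x. trunc R u x - u x) + 2 * L2sq (\<lambda>x. FT 1 (trunc R h) x - u x)) +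
      2 * L2sq (\<lambda>x. trunc R h x - h x)) \<longlongrightarrow> 0 + 0) at_top"
      using fin by (intro tendsto_add ennreal_tendsto_cmult_0 trunc_tendsto) auto
    then show ?thesis by simp
  qed
  from ennreal_tendsto_0_le[OF this le] fin have "L2_limit ?F h" by (simp add: L2_limit_def)
  moreover have "FT (-1) (trunc R (\<lambda>x. of_real (1 / ?c) * u x)) = ?F R" for R
  proof -
    have "trunc R (\<lambda>x. of_real (1 / ?c) * u x) = (\<lambda>x. of_real (1 / ?c) * trunc R u x)"
      by (auto simp: trunc_cases fun_eq_iff)
    then show ?thesis by (intro ext) (simp only: FT_cmult)
  qed
  ultimately show ?thesis by (simp only: L2_FT_def)
qed

section \<open>Propagators and maximal functions\<close>

lemma L2_iff: "f \<in> L2 \<longleftrightarrow> f \<in> borel_measurable borel \<and> L2sq f < top"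
  by (auto simp: L2_def integrable_square_iff_L2sq)

text \<open>The predicate under \<open>SOME\<close> is \<open>L2_limit\<close> itself, so the chosen
  function is a limit as soon as one exists.\<close>

lemma L2_limit_L2_lim:
  assumes "L2_limit F u"
  shows "L2_limit F (L2_lim F)"
proof -
  have "L2_lim F = (SOME u. L2_limit F u)"
    unfolding L2_lim_def L2_limit_def L2_iff L2sq_def conj_assoc ..
  then show ?thesis using assms by (simp add: someI[of "L2_limit F"])
qed

text \<open>The normalising constant is moved onto the input, since this is the form in which
  \<open>L2_FT_inversion\<close> recovers a function.\<close>

lemma L2_FT_fourier:
  fixes f :: "real ^ 'n \<Rightarrow> complex"
  assumes "f \<in> L2"
  shows "L2_FT (-1) (\<lambda>x. of_real (1 / (2 * pi) ^ CARD('n)) * f x) (fourier f)"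
proof -
  let ?c = "complex_of_real (1 / (2 * pi) ^ CARD('n))"
  have [measurable]: "f \<in> borel_measurable borel" and fin: "L2sq f < top"
    using assms by (auto simp: L2_iff)
  have "fourier f = L2_lim (\<lambda>R. FT (-1) (trunc R (\<lambda>x. ?c * f x)))"
  proof -
    have "?c * (LINT x : cball 0 R | lborel. cis (- (x \<bullet> \<xi>)) * f x) = FT (-1) (trunc R (\<lambda>x. ?c * f x)) \<xi>" for R \<xi>
    proof -
      have "trunc R (\<lambda>x. ?c * f x) = (\<lambda>x. ?c * trunc R f x)" by (auto simp: trunc_cases fun_eq_iff)
      then have "FT (-1) (trunc R (\<lambda>x. ?c * f x)) \<xi> = ?c * FT (-1) (trunc R f) \<xi>" by (simp only: FT_cmult)
      then show ?thesis
        unfolding FT_def set_lebesgue_integral_def trunc_def by (simp add: inner_commute)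
    qed
    then show ?thesis unfolding fourier_def by simp
  qed
  moreover obtain u where "L2_FT (-1) (\<lambda>x. ?c * f x) u"
    using L2_FT_exists[of "\<lambda>x. ?c * f x" "-1"] L2sq_finite_cmult[of f ?c] fin by auto
  ultimately show ?thesis unfolding L2_FT_def using L2_limit_L2_lim by metis
qed

lemma fourier_in_L2:
  assumes "f \<in> L2"
  shows "fourier f \<in> L2"
  unfolding L2_iff
  by (intro conjI L2_FT_measurable[OF L2_FT_fourier[OF assms]] L2_FT_finite[OF L2_FT_fourier[OF assms]])

lemma L2sq_cis_mult: "L2sq (\<lambda>\<xi>. cis (h \<xi>) * g \<xi>) = L2sq g"
  by (simp add: L2sq_def norm_mult)

lemma L2_FT_propagator:
  fixes f :: "real ^ 'n \<Rightarrow> complex"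
  assumes f: "f \<in> L2" and [measurable]: "P \<in> borel_measurable borel"
  shows "L2_FT 1 (\<lambda>\<xi>. cis (t * P \<xi>) * fourier f \<xi>) (propagator P t f)"
proof -
  let ?h = "\<lambda>\<xi>. cis (t * P \<xi>) * fourier f \<xi>"
  have [measurable]: "fourier f \<in> borel_measurable borel" and fin: "L2sq (fourier f) < top"
    using fourier_in_L2[OF f] by (auto simp: L2_iff)
  have "(LINT \<xi> : cball 0 R | lborel. cis (x \<bullet> \<xi> + t * P \<xi>) * fourier f \<xi>) = FT 1 (trunc R ?h) x" for R x
    unfolding FT_def set_lebesgue_integral_def trunc_def by (simp add: cis_mult[symmetric] mult.assoc)
  then have "propagator P t f = L2_lim (\<lambda>R. FT 1 (trunc R ?h))"
    unfolding propagator_def by simp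
  moreover obtain u where "L2_FT 1 ?h u"
    using L2_FT_exists[of ?h 1] fin by (auto simp: L2sq_cis_mult)
  ultimately show ?thesis unfolding L2_FT_def using L2_limit_L2_lim by metis
qed

lemma propagator_in_L2:
  assumes "f \<in> L2" "P \<in> borel_measurable borel"
  shows "propagator P t f \<in> L2"
  unfolding L2_iff
  by (intro conjI L2_FT_measurable[OF L2_FT_propagator[OF assms]] L2_FT_finite[OF L2_FT_propagator[OF assms]])

text \<open>The preimage is the inverse transform \<open>u\<close> of \<open>h\<close>. By inversion
  \<open>h\<close> is a forward transform of \<open>u\<close>, and so is \<open>fourier u\<close>;
  uniqueness makes them agree up to a null set.\<close>

lemma fourier_surj:
  fixes h :: "real ^ 'n \<Rightarrow> complex"
  assumes h: "h \<in> L2"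
  shows "\<exists>g \<in> L2. AE \<xi> in lborel. fourier g \<xi> = h \<xi>"
proof -
  have [measurable]: "h \<in> borel_measurable borel" and fin: "L2sq h < top" using h by (auto simp: L2_iff)
  obtain u where u: "L2_FT 1 h u" using L2_FT_exists[of h 1] fin by auto
  then have "u \<in> L2" using L2_FT_measurable L2_FT_finite L2_iff by metis
  moreover have "AE \<xi> in lborel. fourier u \<xi> = h \<xi>"
  proof (rule L2_FT_unique)
    show "L2_FT (-1) (\<lambda>x. of_real (1 / (2 * pi) ^ CARD('n)) * u x) h"
      using L2_FT_inversion[of h u] fin u by simp
    show "(\<lambda>x. complex_of_real (1 / (2 * pi) ^ CARD('n)) * u x) \<in> borel_measurable borel"
      using L2_FT_measurable[OF u] by measurable
  qed (rule L2_FT_fourier[OF \<open>u \<in> L2\<close>])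
  ultimately show ?thesis by blast
qed

lemma L2_FT_diff_bound:
  fixes h :: "'a::euclidean_space \<Rightarrow> complex"
  assumes [measurable]: "h \<in> borel_measurable borel" "k \<in> borel_measurable borel"
    and fin: "L2sq h < top" "L2sq k < top" and \<sigma>: "\<bar>\<sigma>\<bar> = 1" and u: "L2_FT \<sigma> h u" "L2_FT \<sigma> k v"
  shows "L2sq (\<lambda>x. u x - v x) \<le> ennreal (2 * (2 * pi) ^ DIM('a)) * L2sq (\<lambda>x. h x - k x)"
proof (rule L2_FT_bound[OF _ _ \<sigma>])
  have "L2_FT \<sigma> (\<lambda>x. h x + (-1) * k x) (\<lambda>x. u x + (-1) * v x)"
    using fin u by (intro L2_FT_add L2_FT_cmult L2sq_finite_cmult) auto
  then show "L2_FT \<sigma> (\<lambda>x. h x - k x) (\<lambda>x. u x - v x)" by simp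
qed (use fin in \<open>auto intro: L2sq_finite_diff\<close>)

text \<open>On the frequency side \<open>cis (t * P \<xi>)\<close> has modulus \<open>1\<close> and
  is continuous in \<open>t\<close> for each frequency, so dominated convergence works whatever the
  growth of \<open>P\<close>. The result allows restricting the times to a countable set.\<close>

lemma propagator_continuous_L2:
  fixes f :: "real ^ 'n \<Rightarrow> complex"
  assumes f: "f \<in> L2" and [measurable]: "P \<in> borel_measurable borel" and q: "q \<longlonglongrightarrow> t"
  shows "(\<lambda>n. L2sq (\<lambda>x. propagator P (q n) f x - propagator P t f x)) \<longlonglongrightarrow> 0"
proof -
  have [measurable]: "fourier f \<in> borel_measurable borel" and fin: "L2sq (fourier f) < top"
    using fourier_in_L2[OF f] by (auto simp: L2_iff)
  let ?h = "\<lambda>t \<xi>. cis (t * P \<xi>) * fourier f \<xi>"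
  let ?K = "ennreal (2 * (2 * pi) ^ DIM(real ^ 'n))"
  have "(\<lambda>n. L2sq (\<lambda>\<xi>. ?h (q n) \<xi> - ?h t \<xi>)) \<longlonglongrightarrow> 0"
  proof (rule L2sq_tendsto_0_dominated[where w="\<lambda>\<xi>. 2 * fourier f \<xi>"])
    show "AE \<xi> in lborel. cmod (?h (q n) \<xi> - ?h t \<xi>) \<le> cmod (2 * fourier f \<xi>)" for n
    proof (rule AE_I2)
      fix \<xi>
      show "cmod (?h (q n) \<xi> - ?h t \<xi>) \<le> cmod (2 * fourier f \<xi>)"
        using norm_triangle_ineq4[of "?h (q n) \<xi>" "?h t \<xi>"] by (simp add: norm_mult)
    qed
    show "AE \<xi> in lborel. (\<lambda>n. ?h (q n) \<xi> - ?h t \<xi>) \<longlonglongrightarrow> 0"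
    proof (rule AE_I2)
      fix \<xi>
      have "continuous_on UNIV cis" by (intro continuous_intros)
      then have "isCont cis (t * P \<xi>)" by (simp add: continuous_on_eq_continuous_at)
      then have "(\<lambda>n. cis (q n * P \<xi>)) \<longlonglongrightarrow> cis (t * P \<xi>)"
        by (rule isCont_tendsto_compose) (intro tendsto_intros q)
      then have "(\<lambda>n. ?h (q n) \<xi>) \<longlonglongrightarrow> ?h t \<xi>" by (rule tendsto_mult[OF _ tendsto_const])
      then show "(\<lambda>n. ?h (q n) \<xi> - ?h t \<xi>) \<longlonglongrightarrow> 0" by (rule LIM_zero)
    qed
    show "L2sq (\<lambda>\<xi>. 2 * fourier f \<xi>) < top" using fin by (intro L2sq_finite_cmult) auto
  qed measurable
  then have lim: "(\<lambda>n. ?K * L2sq (\<lambda>\<xi>. ?h (q n) \<xi> - ?h t \<xi>)) \<longlonglongrightarrow> 0"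
    by (rule ennreal_tendsto_cmult_0) simp
  show ?thesis
  proof (rule ennreal_tendsto_0_le[OF lim], rule L2_FT_diff_bound)
    show "L2_FT 1 (?h (q n)) (propagator P (q n) f)" for n by (rule L2_FT_propagator[OF f]) measurable
    show "L2_FT 1 (?h t) (propagator P t f)" by (rule L2_FT_propagator[OF f]) measurable
  qed (use fin in \<open>simp_all add: L2sq_cis_mult\<close>)
qed

text \<open>Over countably many times the exceptional sets unite to a null set, which gives
  minimality. Any other time is a limit of rational ones, and along a subsequence the functions
  converge almost everywhere, so the rational supremum majorises it too.\<close>

lemma is_ess_SUP_Rats:
  fixes u :: "real \<Rightarrow> 'a::euclidean_space \<Rightarrow> complex"
  assumes [measurable]: "\<And>t. u t \<in> borel_measurable borel" and fin: "\<And>t. L2sq (u t) < top"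
    and cont: "\<And>q t. q \<longlonglongrightarrow> t \<Longrightarrow> (\<lambda>n. L2sq (\<lambda>x. u (q n) x - u t x)) \<longlonglongrightarrow> 0"
  shows "is_ess_SUP lborel {0<..<1} (\<lambda>t x. ennreal (cmod (u t x)))
    (\<lambda>x. SUP q\<in>\<rat> \<inter> {0<..<1}. ennreal (cmod (u q x)))"
  unfolding is_ess_SUP_def
proof (intro conjI ballI impI)
  have cnt: "countable (\<rat> \<inter> {0<..<1::real})" using countable_rat by blast
  let ?G = "\<lambda>x. SUP q\<in>\<rat> \<inter> {0<..<1}. ennreal (cmod (u q x))"
  show "?G \<in> borel_measurable lborel" by (intro borel_measurable_SUP cnt) measurable
  show "AE x in lborel. ennreal (cmod (u t x)) \<le> ?G x" if t: "t \<in> {0<..<1}" for t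
  proof -
    \<comment> \<open>The approximating times come from the right and stay below \<open>1\<close>,
      so they remain in the open interval.\<close>
    have "\<exists>q\<in>\<rat>. t < q \<and> q < min 1 (t + 1 / Suc n)" for n
      using t by (intro Rats_dense_in_real) auto
    then obtain q where q: "\<And>n. q n \<in> \<rat>" "\<And>n. t < q n" "\<And>n. q n < min 1 (t + 1 / Suc n)" by metis
    have lim: "q \<longlonglongrightarrow> t"
    proof (rule tendsto_sandwich[OF _ _ tendsto_const])
      show "(\<lambda>n. t + 1 / Suc n) \<longlonglongrightarrow> t"
        using tendsto_add[OF tendsto_const LIMSEQ_Suc[OF lim_1_over_n], of t] by simp
    qed (use q in \<open>auto intro!: always_eventually less_imp_le\<close>)
    have "\<exists>r::nat \<Rightarrow> nat. strict_mono r \<and> (AE x in lborel. (\<lambda>n. u (q (r n)) x - u t x) \<longlonglongrightarrow> 0)"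
      by (rule L2sq_tendsto_0_AE_subseq[OF _ _ cont[OF lim]]) (auto intro: L2sq_finite_diff fin)
    then obtain r :: "nat \<Rightarrow> nat" where r: "AE x in lborel. (\<lambda>n. u (q (r n)) x - u t x) \<longlonglongrightarrow> 0" by blast
    then show ?thesis
    proof eventually_elim
      case (elim x)
      then have "(\<lambda>n. ennreal (cmod (u (q (r n)) x))) \<longlonglongrightarrow> ennreal (cmod (u t x))"
        by (intro tendsto_ennrealI tendsto_norm) (simp add: LIM_zero_iff)
      then show ?case
        by (rule LIMSEQ_le_const2) (use q t in \<open>auto intro!: SUP_upper exI[of _ 0] less_trans[OF _ q(2)]\<close>)
    qed
  qed
  show "AE x in lborel. ?G x \<le> H x"
    if "H \<in> borel_measurable lborel" and H: "\<forall>t\<in>{0<..<1}. AE x in lborel. ennreal (cmod (u t x)) \<le> H x" for H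
  proof -
    have "AE x in lborel. \<forall>q\<in>\<rat> \<inter> {0<..<1}. ennreal (cmod (u q x)) \<le> H x"
      using H by (subst AE_ball_countable[OF cnt]) auto
    then show ?thesis by eventually_elim (rule SUP_least, blast)
  qed
qed

text \<open>Existence of some essential supremum is what gives the \<open>SOME\<close> in
  \<open>ess_SUP\<close> its meaning. From here on only the characterisation by
  \<open>is_ess_SUP\<close> is used.\<close>

lemma is_ess_SUP_maximal_function:
  assumes "f \<in> L2" "P \<in> borel_measurable borel"
  shows "is_ess_SUP lborel {0<..<1} (\<lambda>t x. ennreal (cmod (propagator P t f x))) (maximal_function P f)"
proof -
  have "\<exists>G. is_ess_SUP lborel {0<..<1} (\<lambda>t x. ennreal (cmod (propagator P t f x))) G"
    by (intro exI, rule is_ess_SUP_Rats)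
      (use propagator_in_L2[OF assms] propagator_continuous_L2[OF assms] in \<open>simp_all add: L2_iff\<close>)
  then show ?thesis unfolding maximal_function_def ess_SUP_def by (rule someI_ex)
qed

text \<open>The exponential series is summed on the frequency side, where dominated convergence
  gives \<open>L2\<close> convergence, and the boundedness of the transform carries this over to
  space. A subsequence of the partial sums converges almost everywhere; their moduli are bounded by
  the full series on the right, in which \<open>t ^ k\<close> has been replaced by
  \<open>1\<close>.\<close>

lemma propagator_expansion:
  fixes f :: "real ^ 'n \<Rightarrow> complex" and g :: "nat \<Rightarrow> real ^ 'n \<Rightarrow> complex"
  assumes f: "f \<in> L2" and [measurable]: "P \<in> borel_measurable borel" "Q \<in> borel_measurable borel"
    and M: "\<And>\<xi>. \<bar>P \<xi> - Q \<xi>\<bar> \<le> M"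
    and g: "\<And>k. g k \<in> L2" "\<And>k. AE \<xi> in lborel. fourier (g k) \<xi> = of_real ((P \<xi> - Q \<xi>) ^ k) * fourier f \<xi>"
    and t: "t \<in> {0<..<1}"
  shows "AE x in lborel. ennreal (cmod (propagator P t f x)) \<le>
    (\<Sum>k. ennreal (1 / fact k) * ennreal (cmod (propagator Q t (g k) x)))"
proof -
  have [measurable]: "fourier f \<in> borel_measurable borel" "fourier (g k) \<in> borel_measurable borel" for k
    using fourier_in_L2[OF f] fourier_in_L2[OF g(1)] by (auto simp: L2_iff)
  have fin: "L2sq (fourier f) < top" "L2sq (fourier (g k)) < top" for k
    using fourier_in_L2[OF f] fourier_in_L2[OF g(1)] by (auto simp: L2_iff)
  have [measurable]: "propagator P t f \<in> borel_measurable borel" "propagator Q t (g k) \<in> borel_measurable borel" for k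
    using propagator_in_L2[OF f] propagator_in_L2[OF g(1)] by (auto simp: L2_iff)
  have fin': "L2sq (propagator P t f) < top"
    using propagator_in_L2[OF f] by (auto simp: L2_iff)
  define a where "a k = (\<i> * of_real t) ^ k / fact k" for k
  have cmod_a: "cmod (a k) = t ^ k / fact k" for k
    using t by (simp add: a_def norm_divide norm_mult norm_power)
  let ?h = "\<lambda>\<xi>. cis (t * P \<xi>) * fourier f \<xi>"
  let ?m = "\<lambda>k \<xi>. a k * (cis (t * Q \<xi>) * fourier (g k) \<xi>)"
  let ?u = "\<lambda>k x. a k * propagator Q t (g k) x"
  let ?K = "ennreal (2 * (2 * pi) ^ DIM(real ^ 'n))"
  have sum: "L2_FT 1 (\<lambda>\<xi>. \<Sum>k<N. ?m k \<xi>) (\<lambda>x. \<Sum>k<N. ?u k x) \<and> L2sq (\<lambda>\<xi>. \<Sum>k<N. ?m k \<xi>) < top" for N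
    by (rule L2_FT_sum)
      (auto intro!: L2_FT_cmult L2_FT_propagator g L2sq_finite_cmult simp: L2sq_cis_mult fin)
  have M0: "0 \<le> M" using M[of undefined] by linarith
  have bound: "cmod (\<Sum>k<N. a k * of_real ((P \<xi> - Q \<xi>) ^ k)) \<le> exp M" for N \<xi>
  proof -
    have "cmod (\<Sum>k<N. a k * of_real ((P \<xi> - Q \<xi>) ^ k)) \<le> (\<Sum>k<N. M ^ k / fact k)"
    proof (rule order_trans[OF norm_sum sum_mono])
      fix k
      have "t ^ k * \<bar>P \<xi> - Q \<xi>\<bar> ^ k \<le> 1 * M ^ k"
        using t M[of \<xi>] by (intro mult_mono power_mono power_le_one) auto
      then show "cmod (a k * of_real ((P \<xi> - Q \<xi>) ^ k)) \<le> M ^ k / fact k"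
        by (simp only: norm_mult cmod_a norm_of_real power_abs) (simp add: divide_right_mono)
    qed
    also have "\<dots> \<le> exp M"
    proof -
      have "(\<Sum>k<N. M ^ k /\<^sub>R fact k) \<le> exp M"
        unfolding exp_def by (rule sum_le_suminf[OF summable_exp_generic]) (use M0 in auto)
      moreover have "M ^ k / fact k = M ^ k /\<^sub>R fact k" for k by (simp add: divide_inverse)
      ultimately show ?thesis by (simp only:)
    qed
    finally show ?thesis .
  qed
  have exp_sums: "(\<lambda>N. \<Sum>k<N. a k * of_real ((P \<xi> - Q \<xi>) ^ k)) \<longlonglongrightarrow> cis (t * (P \<xi> - Q \<xi>))" for \<xi>
  proof -
    have "(\<lambda>k. (\<i> * of_real (t * (P \<xi> - Q \<xi>))) ^ k /\<^sub>R fact k) sums exp (\<i> * of_real (t * (P \<xi> - Q \<xi>)))"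
      by (rule exp_converges)
    moreover have "(\<i> * of_real (t * (P \<xi> - Q \<xi>))) ^ k /\<^sub>R fact k = a k * of_real ((P \<xi> - Q \<xi>) ^ k)" for k
    proof -
      have "(\<i> * complex_of_real (t * r)) ^ k = (\<i> * of_real t) ^ k * of_real (r ^ k)" for r
        by (simp add: power_mult_distrib)
      then show ?thesis unfolding a_def by (simp only:) (simp add: scaleR_conv_of_real divide_inverse)
    qed
    ultimately show ?thesis by (simp add: sums_def cis_conv_exp)
  qed
  have eq: "AE \<xi> in lborel. \<forall>N. (\<Sum>k<N. ?m k \<xi>) = cis (t * Q \<xi>) * (\<Sum>k<N. a k * of_real ((P \<xi> - Q \<xi>) ^ k)) * fourier f \<xi>"
  proof -
    have "AE \<xi> in lborel. \<forall>k. fourier (g k) \<xi> = of_real ((P \<xi> - Q \<xi>) ^ k) * fourier f \<xi>"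
      unfolding AE_all_countable using g(2) by blast
    then show ?thesis
      by eventually_elim (simp only: sum_distrib_left sum_distrib_right ac_simps simp_thms)
  qed
  have "(\<lambda>N. L2sq (\<lambda>\<xi>. ?h \<xi> - (\<Sum>k<N. ?m k \<xi>))) \<longlonglongrightarrow> 0"
  \<comment> \<open>In the majorant, \<open>1\<close> accounts for the limit and
    \<open>exp M\<close> for the partial sums, uniformly in their length.\<close>
  proof (rule L2sq_tendsto_0_dominated[where w="\<lambda>\<xi>. of_real (1 + exp M) * fourier f \<xi>"])
    show "L2sq (\<lambda>\<xi>. of_real (1 + exp M) * fourier f \<xi>) < top"
      by (rule L2sq_finite_cmult) (simp_all add: fin)
    show "AE \<xi> in lborel. cmod (?h \<xi> - (\<Sum>k<N. ?m k \<xi>)) \<le> cmod (of_real (1 + exp M) * fourier f \<xi>)" for N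
      using eq
    proof eventually_elim
      case (elim \<xi>)
      have "cmod (?h \<xi> - (\<Sum>k<N. ?m k \<xi>)) \<le> cmod (?h \<xi>) + cmod (\<Sum>k<N. ?m k \<xi>)"
        by (rule norm_triangle_ineq4)
      also have "\<dots> = (1 + cmod (\<Sum>k<N. a k * of_real ((P \<xi> - Q \<xi>) ^ k))) * cmod (fourier f \<xi>)"
        using elim by (simp only: norm_mult norm_cis mult_1 distrib_right)
      also have "\<dots> \<le> (1 + exp M) * cmod (fourier f \<xi>)"
        by (intro mult_right_mono add_left_mono bound) simp
      also have "\<dots> = cmod (of_real (1 + exp M) * fourier f \<xi>)"
        unfolding norm_mult norm_of_real by (simp add: add_pos_pos)
      finally show ?case .
    qed
    show "AE \<xi> in lborel. (\<lambda>N. ?h \<xi> - (\<Sum>k<N. ?m k \<xi>)) \<longlonglongrightarrow> 0"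
      using eq
    proof eventually_elim
      case (elim \<xi>)
      have "(\<lambda>N. ?h \<xi> - (\<Sum>k<N. ?m k \<xi>)) \<longlonglongrightarrow> ?h \<xi> - cis (t * Q \<xi>) * cis (t * (P \<xi> - Q \<xi>)) * fourier f \<xi>"
        using elim by (simp only:) (intro tendsto_diff tendsto_mult tendsto_const exp_sums)
      also have "?h \<xi> - cis (t * Q \<xi>) * cis (t * (P \<xi> - Q \<xi>)) * fourier f \<xi> = 0"
        by (simp add: cis_mult algebra_simps)
      finally show ?case .
    qed
  qed measurable
  then have lim: "(\<lambda>N. ?K * L2sq (\<lambda>\<xi>. ?h \<xi> - (\<Sum>k<N. ?m k \<xi>))) \<longlonglongrightarrow> 0"
    by (rule ennreal_tendsto_cmult_0) simp
  have lim': "(\<lambda>N. L2sq (\<lambda>x. propagator P t f x - (\<Sum>k<N. ?u k x))) \<longlonglongrightarrow> 0"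
  proof (rule ennreal_tendsto_0_le[OF lim], rule L2_FT_diff_bound)
    show "L2_FT 1 ?h (propagator P t f)" by (rule L2_FT_propagator[OF f]) measurable
  qed (use sum fin in \<open>auto simp: L2sq_cis_mult\<close>)
  have "\<exists>r::nat \<Rightarrow> nat. strict_mono r \<and> (AE x in lborel. (\<lambda>n. propagator P t f x - (\<Sum>k<r n. ?u k x)) \<longlonglongrightarrow> 0)"
  proof (rule L2sq_tendsto_0_AE_subseq[OF _ _ lim'])
    show "L2sq (\<lambda>x. propagator P t f x - (\<Sum>k<N. ?u k x)) < top" for N
      using fin' L2_FT_finite[of 1 "\<lambda>\<xi>. \<Sum>k<N. ?m k \<xi>"] sum by (intro L2sq_finite_diff) auto
  qed measurable
  then obtain r :: "nat \<Rightarrow> nat" where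
    "AE x in lborel. (\<lambda>n. propagator P t f x - (\<Sum>k<r n. ?u k x)) \<longlonglongrightarrow> 0" by blast
  then show ?thesis
  proof eventually_elim
    case (elim x)
    have "(\<lambda>n. propagator P t f x - (propagator P t f x - (\<Sum>k<r n. ?u k x))) \<longlonglongrightarrow> propagator P t f x - 0"
      by (intro tendsto_intros elim)
    then have "(\<lambda>n. ennreal (cmod (\<Sum>k<r n. ?u k x))) \<longlonglongrightarrow> ennreal (cmod (propagator P t f x))"
      by (intro tendsto_ennrealI tendsto_norm) simp
    then show ?case
    proof (rule LIMSEQ_le_const2, intro exI allI impI)
      fix n
      have "cmod (?u k x) \<le> 1 / fact k * cmod (propagator Q t (g k) x)" for k
      proof -
        have "t ^ k \<le> 1" using t by (intro power_le_one) auto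
        then have "cmod (a k) \<le> 1 / fact k"
          by (simp add: cmod_a divide_right_mono)
        then show ?thesis unfolding norm_mult by (rule mult_right_mono) simp
      qed
      then have "cmod (\<Sum>k<r n. ?u k x) \<le> (\<Sum>k<r n. 1 / fact k * cmod (propagator Q t (g k) x))"
        by (intro order_trans[OF norm_sum sum_mono])
      then have "ennreal (cmod (\<Sum>k<r n. ?u k x)) \<le> ennreal (\<Sum>k<r n. 1 / fact k * cmod (propagator Q t (g k) x))"
        by (rule ennreal_leI)
      also have "\<dots> = (\<Sum>k<r n. ennreal (1 / fact k) * ennreal (cmod (propagator Q t (g k) x)))"
        by (simp add: ennreal_mult'[symmetric] sum_nonneg)
      also have "\<dots> \<le> (\<Sum>k. ennreal (1 / fact k) * ennreal (cmod (propagator Q t (g k) x)))"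
        by (rule sum_le_suminf) auto
      finally show "ennreal (cmod (\<Sum>k<r n. ?u k x)) \<le>
          (\<Sum>k. ennreal (1 / fact k) * ennreal (cmod (propagator Q t (g k) x)))" .
    qed
  qed
qed

text \<open>The series on the right is one measurable function that majorises each time almost
  everywhere, so minimality of the essential supremum applies although the exceptional sets depend
  on the time.\<close>

lemma maximal_function_expansion:
  fixes f :: "real ^ 'n \<Rightarrow> complex" and g :: "nat \<Rightarrow> real ^ 'n \<Rightarrow> complex"
  assumes f: "f \<in> L2" and P: "P \<in> borel_measurable borel" and Q: "Q \<in> borel_measurable borel"
    and M: "\<And>\<xi>. \<bar>P \<xi> - Q \<xi>\<bar> \<le> M"
    and g: "\<And>k. g k \<in> L2" "\<And>k. AE \<xi> in lborel. fourier (g k) \<xi> = of_real ((P \<xi> - Q \<xi>) ^ k) * fourier f \<xi>"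
  shows "AE x in lborel. maximal_function P f x \<le> (\<Sum>k. ennreal (1 / fact k) * maximal_function Q (g k) x)"
proof -
  note mP = is_ess_SUP_maximal_function[OF f P] and mQ = is_ess_SUP_maximal_function[OF g(1) Q]
  have [measurable]: "maximal_function Q (g k) \<in> borel_measurable lborel" for k
    using mQ by (simp add: is_ess_SUP_def)
  let ?H = "\<lambda>x. \<Sum>k. ennreal (1 / fact k) * maximal_function Q (g k) x"
  have "AE x in lborel. ennreal (cmod (propagator P t f x)) \<le> ?H x" if t: "t \<in> {0<..<1}" for t
  proof -
    have "AE x in lborel. \<forall>k. ennreal (cmod (propagator Q t (g k) x)) \<le> maximal_function Q (g k) x"
      unfolding AE_all_countable using mQ t by (simp add: is_ess_SUP_def)
    with propagator_expansion[OF f P Q M g t] show ?thesis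
    proof eventually_elim
      case (elim x)
      note elim(1)
      also have "(\<Sum>k. ennreal (1 / fact k) * ennreal (cmod (propagator Q t (g k) x))) \<le> ?H x"
        using elim(2) by (intro suminf_le mult_left_mono) auto
      finally show ?case .
    qed
  qed
  moreover have "?H \<in> borel_measurable lborel" by measurable
  ultimately show ?thesis
    using mP[unfolded is_ess_SUP_def, THEN conjunct2, THEN conjunct2, THEN bspec[of _ _ ?H]] by simp
qed

section \<open>Comparison of the maximal functions in \<open>L\<^sup>p\<close>\<close>

lemma ennreal_powr_mono:
  assumes "p \<ge> 0" "x \<le> y"
  shows "ennreal_powr x p \<le> ennreal_powr y p"
proof (cases "y = \<infinity>")
  case True
  then show ?thesis by (simp add: ennreal_powr_def)
next
  case False
  then have "x \<noteq> \<infinity>" using assms(2) by (auto simp: top_unique)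
  with False assms show ?thesis
    by (auto simp: ennreal_powr_def less_top intro!: ennreal_leI powr_mono2 enn2real_mono)
qed

lemma ennreal_powr_ennreal: "b \<ge> 0 \<Longrightarrow> ennreal_powr (ennreal b) p = ennreal (b powr p)"
  by (simp add: ennreal_powr_def)

lemma ennreal_powr_le_cancel:
  assumes p: "p > 0" and b: "b \<ge> 0" and le: "ennreal_powr y p \<le> ennreal b"
  shows "y \<le> ennreal (b powr (1 / p))"
proof -
  have y: "y \<noteq> top" using le by (auto simp: ennreal_powr_def top_unique)
  then have "enn2real y powr p \<le> b" using le b by (simp add: ennreal_powr_def)
  then have "(enn2real y powr p) powr (1 / p) \<le> b powr (1 / p)"
    using p by (intro powr_mono2) auto
  then have "enn2real y \<le> b powr (1 / p)" using p by (simp add: powr_powr)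
  then have "ennreal (enn2real y) \<le> ennreal (b powr (1 / p))" by (rule ennreal_leI)
  then show ?thesis using y by (simp add: ennreal_enn2real_if)
qed

lemma ennreal_powr_cmult:
  assumes "c > 0"
  shows "ennreal_powr (ennreal c * y) p = ennreal (c powr p) * ennreal_powr y p"
proof (cases "y = top")
  case True
  then show ?thesis using assms by (simp add: ennreal_powr_def ennreal_mult_eq_top_iff ennreal_mult_top)
next
  case False
  then obtain b where b: "b \<ge> 0" "y = ennreal b" by (cases y) auto
  then show ?thesis using assms
    by (simp add: ennreal_mult'[symmetric] ennreal_powr_ennreal powr_mult)
qed

lemma borel_measurable_ennreal_powr [measurable]:
  assumes [measurable]: "f \<in> borel_measurable M"
  shows "(\<lambda>x. ennreal_powr (f x) p) \<in> borel_measurable M"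
  unfolding ennreal_powr_def by measurable

text \<open>Weighting the terms by \<open>2\<^sup>-\<^sup>k\<^sup>-\<^sup>1\<close> replaces the countable Minkowski inequality.\<close>

lemma ennreal_powr_suminf_le:
  fixes z :: "nat \<Rightarrow> ennreal"
  assumes p: "p > 0"
  shows "ennreal_powr (\<Sum>k. z k) p \<le> (\<Sum>k. ennreal_powr (ennreal (2 ^ Suc k) * z k) p)"
proof (cases "(\<Sum>k. ennreal_powr (ennreal (2 ^ Suc k) * z k) p) = top")
  case False
  then obtain e where e: "e \<ge> 0" "(\<Sum>k. ennreal_powr (ennreal (2 ^ Suc k) * z k) p) = ennreal e"
    by (cases "\<Sum>k. ennreal_powr (ennreal (2 ^ Suc k) * z k) p") auto
  \<comment> \<open>If the right-hand side is \<open>e\<close>, each of its terms is at most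
    \<open>e\<close>, so \<open>z k\<close> is at most \<open>b * (1 / 2) ^ Suc k\<close>; these
    bounds sum to exactly \<open>b\<close>, whose \<open>p\<close>-th power is
    \<open>e\<close>.\<close>
  define b where "b = e powr (1 / p)"
  have "z k \<le> ennreal (b * (1 / 2) ^ Suc k)" for k
  proof -
    have "ennreal_powr (ennreal (2 ^ Suc k) * z k) p \<le> ennreal e"
      unfolding e(2)[symmetric] by (rule ennreal_le_suminf)
    then have "ennreal (2 ^ Suc k) * z k \<le> ennreal b"
      unfolding b_def by (rule ennreal_powr_le_cancel[OF p e(1)])
    then have "ennreal ((1 / 2) ^ Suc k) * (ennreal (2 ^ Suc k) * z k) \<le> ennreal ((1 / 2) ^ Suc k) * ennreal b"
      by (rule mult_left_mono) simp
    moreover have "(1 / 2) ^ Suc k * 2 ^ Suc k = (1::real)"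
      unfolding power_mult_distrib[symmetric] by simp
    then have "ennreal ((1 / 2) ^ Suc k) * ennreal (2 ^ Suc k) = 1"
      by (subst ennreal_mult'[symmetric]) (simp_all only: ennreal_1 zero_le_power zero_le_divide_1_iff zero_le_numeral)
    moreover have "ennreal ((1 / 2) ^ Suc k) * ennreal b = ennreal (b * (1 / 2) ^ Suc k)"
      by (subst mult.commute[of b], subst ennreal_mult') (auto simp: b_def)
    ultimately show ?thesis by (simp only: mult.assoc[symmetric] mult_1)
  qed
  then have "(\<Sum>k. z k) \<le> (\<Sum>k. ennreal (b * (1 / 2) ^ Suc k))"
    by (intro suminf_le) auto
  also have "\<dots> = ennreal b"
    by (rule suminf_ennreal_eq) (use sums_mult[OF power_half_series, of b] in \<open>auto simp: b_def\<close>)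
  finally have "ennreal_powr (\<Sum>k. z k) p \<le> ennreal_powr (ennreal b) p"
    using p by (intro ennreal_powr_mono) auto
  also have "\<dots> = ennreal e" using p e(1) by (simp add: ennreal_powr_ennreal b_def powr_powr)
  finally show ?thesis using e(2) by simp
qed (simp only: top_greatest)

text \<open>The weights \<open>2 ^ Suc k\<close>, the coefficients \<open>1 / fact k\<close> and the
  growth \<open>M ^ k\<close> combine to \<open>v k\<close>, whose sum \<open>V\<close> is
  \<open>2 * exp (2 * M)\<close>. Since \<open>v k\<close> is at most \<open>V\<close> and
  \<open>p\<close> at least \<open>1\<close>, \<open>v k powr p\<close> is at most
  \<open>V powr (p - 1) * v k\<close>; summation gives \<open>V powr p\<close>, and the
  \<open>p\<close>-th root restores \<open>V\<close>.\<close>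

lemma Lp_norm_suminf_le:
  fixes G :: "nat \<Rightarrow> real ^ 'n \<Rightarrow> ennreal"
  assumes p: "p \<ge> 1" and [measurable]: "A \<in> sets borel" "\<And>k. G k \<in> borel_measurable borel"
    and M: "M \<ge> 0" and B: "B \<ge> 0"
    and le: "AE x in lborel. F x \<le> (\<Sum>k. ennreal (1 / fact k) * G k x)"
    and norm: "\<And>k. Lp_norm p A (G k) \<le> ennreal (B * M ^ k)"
  shows "Lp_norm p A F \<le> ennreal (2 * exp (2 * M) * B)"
proof -
  define v where "v k = 2 * ((2 * M) ^ k / fact k)" for k :: nat
  define V where "V = 2 * exp (2 * M)"
  have v: "v k \<ge> 0" for k using M by (simp add: v_def)
  have vV: "v sums V"
    using sums_mult[OF exp_converges[of "2 * M"], of 2]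
    by (simp add: v_def[abs_def] V_def divide_inverse mult.commute)
  have V0: "V > 0" by (simp add: V_def)
  have v_le: "v k \<le> V" for k
    using sum_le_suminf[OF sums_summable[OF vV], of "{k}"] v sums_unique[OF vV] by simp
  let ?I = "\<lambda>H. \<integral>\<^sup>+x\<in>A. ennreal_powr (H x) p \<partial>lborel"
  have I: "?I (G k) \<le> ennreal ((B * M ^ k) powr p)" for k
    using ennreal_powr_le_cancel[of "1 / p" "B * M ^ k" "?I (G k)"] norm[of k] p B M
    by (simp add: Lp_norm_def)
  have pt: "ennreal_powr (ennreal (2 ^ Suc k) * (ennreal (1 / fact k) * y)) p =
      ennreal ((2 ^ Suc k / fact k) powr p) * ennreal_powr y p" for k :: nat and y
  proof -
    have "ennreal (2 ^ Suc k) * (ennreal (1 / fact k) * y) = ennreal (2 ^ Suc k / fact k) * y"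
      unfolding mult.assoc[symmetric] by (subst ennreal_mult'[symmetric]) auto
    then show ?thesis by (simp only:) (rule ennreal_powr_cmult, simp)
  qed
  have "?I F \<le> (\<integral>\<^sup>+x. (\<Sum>k. ennreal ((2 ^ Suc k / fact k) powr p) * (ennreal_powr (G k x) p * indicator A x)) \<partial>lborel)"
  proof (rule nn_integral_mono_AE)
    from le show "AE x in lborel. ennreal_powr (F x) p * indicator A x \<le>
        (\<Sum>k. ennreal ((2 ^ Suc k / fact k) powr p) * (ennreal_powr (G k x) p * indicator A x))"
    proof eventually_elim
      case (elim x)
      have "ennreal_powr (F x) p \<le> ennreal_powr (\<Sum>k. ennreal (1 / fact k) * G k x) p"
        using p elim by (intro ennreal_powr_mono) auto
      also have "\<dots> \<le> (\<Sum>k. ennreal_powr (ennreal (2 ^ Suc k) * (ennreal (1 / fact k) * G k x)) p)"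
        by (rule ennreal_powr_suminf_le) (use p in auto)
      also have "\<dots> = (\<Sum>k. ennreal ((2 ^ Suc k / fact k) powr p) * ennreal_powr (G k x) p)"
        by (simp only: pt)
      finally have "ennreal_powr (F x) p * indicator A x \<le>
          (\<Sum>k. ennreal ((2 ^ Suc k / fact k) powr p) * ennreal_powr (G k x) p) * indicator A x"
        by (rule mult_right_mono) simp
      also have "\<dots> = (\<Sum>k. ennreal ((2 ^ Suc k / fact k) powr p) * (ennreal_powr (G k x) p * indicator A x))"
        by (simp only: ennreal_suminf_multc[symmetric] mult.assoc)
      finally show ?case .
    qed
  qed
  also have "\<dots> = (\<Sum>k. ennreal ((2 ^ Suc k / fact k) powr p) * ?I (G k))"
    by (subst nn_integral_suminf) (auto simp: nn_integral_cmult)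
  also have "\<dots> \<le> (\<Sum>k. ennreal (B powr p * V powr (p - 1) * v k))"
  proof (intro suminf_le)
    fix k
    have "ennreal ((2 ^ Suc k / fact k) powr p) * ?I (G k) \<le>
        ennreal ((2 ^ Suc k / fact k) powr p) * ennreal ((B * M ^ k) powr p)"
      by (intro mult_left_mono I) simp
    also have "\<dots> = ennreal ((2 ^ Suc k / fact k * (B * M ^ k)) powr p)"
      using B M by (subst ennreal_mult'[symmetric], simp, subst powr_mult[symmetric]) auto
    also have "2 ^ Suc k / fact k * (B * M ^ k) = B * v k"
      by (simp add: v_def power_mult_distrib)
    also have "(B * v k) powr p \<le> B powr p * V powr (p - 1) * v k"
    \<comment> \<open>\<open>v k\<close> does vanish when \<open>M = 0\<close> and \<open>k\<close>
      is positive; splitting off one factor of the power requires a positive base.\<close>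
    proof (cases "v k = 0")
      case False
      then have vk: "v k > 0" using v[of k] by simp
      have "v k powr p = v k powr (p - 1) * v k"
        using vk powr_add[of "v k" "p - 1" 1] by simp
      also have "\<dots> \<le> V powr (p - 1) * v k"
        using v_le v p by (intro mult_right_mono powr_mono2) auto
      finally show ?thesis using B v
        by (simp add: powr_mult mult_left_mono mult.assoc)
    qed simp
    finally show "ennreal ((2 ^ Suc k / fact k) powr p) * ?I (G k) \<le> ennreal (B powr p * V powr (p - 1) * v k)"
      by (simp add: ennreal_leI)
  qed auto
  also have "\<dots> = ennreal (B powr p * V powr (p - 1) * V)"
    by (rule suminf_ennreal_eq) (use v sums_mult[OF vV] in auto)
  also have "B powr p * V powr (p - 1) * V = (V * B) powr p"
    using V0 B powr_add[of V "p - 1" 1] by (simp add: powr_mult)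
  finally have "Lp_norm p A F \<le> ennreal_powr (ennreal ((V * B) powr p)) (1 / p)"
    unfolding Lp_norm_def using p by (intro ennreal_powr_mono) auto
  also have "\<dots> = ennreal (V * B)"
    using V0 B p by (simp add: ennreal_powr_ennreal powr_powr)
  finally show ?thesis by (simp add: V_def)
qed

section \<open>Bounded multipliers on Sobolev spaces, and the maximal estimate\<close>

lemma sobolev_multiplier:
  fixes f g :: "real ^ 'n \<Rightarrow> complex" and m :: "real ^ 'n \<Rightarrow> real"
  assumes f: "f \<in> sobolev s" and g: "g \<in> L2"
    and [measurable]: "m \<in> borel_measurable borel" and K: "\<And>\<xi>. \<bar>m \<xi>\<bar> \<le> K"
    and eq: "AE \<xi> in lborel. fourier g \<xi> = of_real (m \<xi>) * fourier f \<xi>"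
  shows "g \<in> sobolev s" and "sobolev_norm s g \<le> K * sobolev_norm s f"
proof -
  have fL: "f \<in> L2" using f by (simp add: sobolev_def)
  have [measurable]: "fourier f \<in> borel_measurable borel" "fourier g \<in> borel_measurable borel"
    using fourier_in_L2[OF fL] fourier_in_L2[OF g] by (auto simp: L2_iff)
  let ?w = "\<lambda>h \<xi>. (1 + (norm \<xi>)\<^sup>2) powr s * (cmod (fourier h \<xi>))\<^sup>2"
  have K0: "K \<ge> 0" using K[of undefined] by linarith
  have intf: "integrable lborel (?w f)" using f by (simp add: sobolev_def)
  have le: "AE \<xi> in lborel. ?w g \<xi> \<le> K\<^sup>2 * ?w f \<xi>"
    using eq
  proof eventually_elim
    case (elim \<xi>)
    have "(cmod (fourier g \<xi>))\<^sup>2 = \<bar>m \<xi>\<bar>\<^sup>2 * (cmod (fourier f \<xi>))\<^sup>2"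
      unfolding elim norm_mult norm_of_real power_mult_distrib ..
    also have "\<dots> \<le> K\<^sup>2 * (cmod (fourier f \<xi>))\<^sup>2"
      by (intro mult_right_mono power_mono K) auto
    finally have "(1 + (norm \<xi>)\<^sup>2) powr s * (cmod (fourier g \<xi>))\<^sup>2 \<le>
        (1 + (norm \<xi>)\<^sup>2) powr s * (K\<^sup>2 * (cmod (fourier f \<xi>))\<^sup>2)"
      by (rule mult_left_mono) simp
    then show ?case by (simp only: mult.left_commute)
  qed
  have intg: "integrable lborel (?w g)"
  proof (rule Bochner_Integration.integrable_bound)
    show "integrable lborel (\<lambda>\<xi>. K\<^sup>2 * ?w f \<xi>)" using intf by (intro integrable_mult_right)
    show "AE \<xi> in lborel. norm (?w g \<xi>) \<le> norm (K\<^sup>2 * ?w f \<xi>)"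
      using le by eventually_elim (auto simp: abs_mult)
  qed measurable
  with g show "g \<in> sobolev s" by (simp add: sobolev_def)
  have "(LINT \<xi>|lborel. ?w g \<xi>) \<le> (LINT \<xi>|lborel. K\<^sup>2 * ?w f \<xi>)"
    by (rule integral_mono_AE[OF intg _ le]) (intro integrable_mult_right intf)
  then have "(LINT \<xi>|lborel. ?w g \<xi>) \<le> K\<^sup>2 * (LINT \<xi>|lborel. ?w f \<xi>)" by simp
  then have "sqrt (LINT \<xi>|lborel. ?w g \<xi>) \<le> sqrt (K\<^sup>2 * (LINT \<xi>|lborel. ?w f \<xi>))" by simp
  then show "sobolev_norm s g \<le> K * sobolev_norm s f"
    using K0 by (simp add: sobolev_norm_def real_sqrt_mult)
qed

lemma continuous_bounded_outside_ball_imp_bounded: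
  fixes h :: "'a::euclidean_space \<Rightarrow> real"
  assumes "continuous_on UNIV h" and out: "\<And>\<xi>. norm \<xi> \<ge> R \<Longrightarrow> \<bar>h \<xi>\<bar> \<le> C"
  shows "\<exists>M. \<forall>\<xi>. \<bar>h \<xi>\<bar> \<le> M"
proof -
  have "bounded (h ` cball 0 R)"
    using assms(1) by (intro compact_imp_bounded compact_continuous_image continuous_on_subset[OF assms(1)]) auto
  then obtain b where b: "\<And>\<xi>. norm \<xi> \<le> R \<Longrightarrow> \<bar>h \<xi>\<bar> \<le> b" unfolding bounded_iff by fastforce
  have "\<bar>h \<xi>\<bar> \<le> max b C" for \<xi>
    using b[of \<xi>] out[of \<xi>] by (cases "norm \<xi> \<le> R") auto
  then show ?thesis by blast
qed

theorem theorem1p1: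
  fixes P Q :: "real ^ 'n \<Rightarrow> real" and p s\<^sub>0 :: real
  assumes "continuous_on UNIV P"
    and "p \<ge> 1"
    and "continuous_on UNIV Q"
    and "s\<^sub>0 > 0"
    and "\<exists>C>0. \<exists>R\<^sub>0>0. \<forall>\<xi>. norm \<xi> \<ge> R\<^sub>0 \<longrightarrow> \<bar>P \<xi> - Q \<xi>\<bar> \<le> C"
    and "\<forall>s>s\<^sub>0. \<exists>C>0. \<forall>f \<in> sobolev s.
           Lp_norm p (ball 0 1) (maximal_function Q f) \<le> ennreal (C * sobolev_norm s f)"
  shows "\<forall>s>s\<^sub>0. \<exists>C>0. \<forall>f \<in> sobolev s.
           Lp_norm p (ball 0 1) (maximal_function P f) \<le> ennreal (C * sobolev_norm s f)"
proof (intro allI impI)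
  fix s assume "s > s\<^sub>0"
  then obtain C where C: "C > 0" and Qbound: "\<And>f. f \<in> sobolev s \<Longrightarrow>
      Lp_norm p (ball 0 1) (maximal_function Q f) \<le> ennreal (C * sobolev_norm s f)"
    using assms(6) by blast
  have PQ: "continuous_on UNIV (\<lambda>\<xi>. P \<xi> - Q \<xi>)"
    using assms(1,3) by (intro continuous_intros)
  obtain M where M: "\<And>\<xi>. \<bar>P \<xi> - Q \<xi>\<bar> \<le> M"
    using assms(5) continuous_bounded_outside_ball_imp_bounded[OF PQ] by meson
  have M0: "M \<ge> 0" using M[of 0] by linarith
  have Pm: "P \<in> borel_measurable borel" and Qm: "Q \<in> borel_measurable borel"
    using assms(1,3) by (auto intro: borel_measurable_continuous_onI)
  note [measurable] = Pm Qm
  show "\<exists>C>0. \<forall>f \<in> sobolev s.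
      Lp_norm p (ball 0 1) (maximal_function P f) \<le> ennreal (C * sobolev_norm s f)"
  proof (intro exI conjI ballI)
    \<comment> \<open>\<open>M\<close> and \<open>C\<close> are fixed before \<open>f\<close>, so
      the constant is independent of \<open>f\<close>. The factor \<open>C\<close> is that of the
      estimate for \<open>Q\<close> at the same exponent \<open>s\<close>.\<close>
    show "2 * exp (2 * M) * C > 0" using C by simp
    fix f :: "real ^ 'n \<Rightarrow> complex" assume f: "f \<in> sobolev s"
    then have fL: "f \<in> L2" by (simp add: sobolev_def)
    have [measurable]: "fourier f \<in> borel_measurable borel" and fin: "L2sq (fourier f) < top"
      using fourier_in_L2[OF fL] by (auto simp: L2_iff)
    have Mk: "\<bar>(P \<xi> - Q \<xi>) ^ k\<bar> \<le> M ^ k" for k \<xi>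
      unfolding power_abs by (intro power_mono M) simp
    \<comment> \<open>The estimate for \<open>Q\<close> speaks of functions in the Sobolev space,
      not of their transforms, so each prescribed transform has to be realised by an actual
      function.\<close>
    have "\<exists>g \<in> L2. AE \<xi> in lborel. fourier g \<xi> = of_real ((P \<xi> - Q \<xi>) ^ k) * fourier f \<xi>" for k
    proof (rule fourier_surj)
      have "L2sq (\<lambda>\<xi>. of_real ((P \<xi> - Q \<xi>) ^ k) * fourier f \<xi>) \<le> L2sq (\<lambda>\<xi>. of_real (M ^ k) * fourier f \<xi>)"
      proof (rule L2sq_mono)
        fix \<xi>
        show "cmod (of_real ((P \<xi> - Q \<xi>) ^ k) * fourier f \<xi>) \<le> cmod (of_real (M ^ k) * fourier f \<xi>)"
          unfolding norm_mult norm_of_real using order_trans[OF Mk abs_ge_self] by (intro mult_right_mono) auto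
      qed
      also have "\<dots> < top" by (rule L2sq_finite_cmult) (simp_all add: fin)
      finally show "(\<lambda>\<xi>. of_real ((P \<xi> - Q \<xi>) ^ k) * fourier f \<xi>) \<in> L2"
        unfolding L2_iff by (intro conjI) measurable
    qed
    then obtain g where g: "\<And>k. g k \<in> L2"
      "\<And>k. AE \<xi> in lborel. fourier (g k) \<xi> = of_real ((P \<xi> - Q \<xi>) ^ k) * fourier f \<xi>"
      by metis
    have m: "(\<lambda>\<xi>. (P \<xi> - Q \<xi>) ^ k) \<in> borel_measurable borel" for k by measurable
    note sob = sobolev_multiplier[OF f g(1) m Mk g(2)]
    have "Lp_norm p (ball 0 1) (maximal_function P f) \<le> ennreal (2 * exp (2 * M) * (C * sobolev_norm s f))"
    proof (rule Lp_norm_suminf_le[OF assms(2) _ _ M0])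
      show "maximal_function Q (g k) \<in> borel_measurable borel" for k
        using is_ess_SUP_maximal_function[OF g(1) Qm, of k] by (simp add: is_ess_SUP_def)
      show "0 \<le> C * sobolev_norm s f"
        using C by (auto simp: sobolev_norm_def intro!: mult_nonneg_nonneg)
      show "AE x in lborel. maximal_function P f x \<le> (\<Sum>k. ennreal (1 / fact k) * maximal_function Q (g k) x)"
        by (rule maximal_function_expansion[OF fL Pm Qm M g])
      show "Lp_norm p (ball 0 1) (maximal_function Q (g k)) \<le> ennreal (C * sobolev_norm s f * M ^ k)" for k
      proof (rule order_trans[OF Qbound[OF sob(1)] ennreal_leI])
        have "C * sobolev_norm s (g k) \<le> C * (M ^ k * sobolev_norm s f)"
          using C by (intro mult_left_mono sob(2)) auto
        then show "C * sobolev_norm s (g k) \<le> C * sobolev_norm s f * M ^ k" by (simp only: ac_simps)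
      qed
    qed simp
    then show "Lp_norm p (ball 0 1) (maximal_function P f) \<le> ennreal (2 * exp (2 * M) * C * sobolev_norm s f)"
      by (simp only: mult.assoc)
  qed
qed

end
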